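(* Let $\eta\in\Omega_{<\infty}$. Then for any $k\in\mathbb N$ and $x\in\mathbb N$, $$\eta^\uparrow_k(x)+\eta^\downarrow_k(x)=1\quad\text{if and only if}\quad\nu(x)=k-1.$$ In particular, for any $k\in\mathbb N$, $i\in\mathbb Z_{\ge0}$ and $x\in\mathbb Z_{\ge0}$, we have $\tilde\xi_k(x)=\xi_k(x)$ and $\tilde\zeta_k(i)=\zeta_k(i)$.
   Context: $\mathbb N=\{1,2,\dots\}$, $\Omega=\{0,1\}^{\mathbb N}$, $\Omega_{<\infty}=\{\eta\in\Omega\ ;\ \sum_{x\in\mathbb N}\eta(x)<\infty\}$. Seat numbers: for $\eta\in\Omega$ define $\mathcal W_k:\mathbb Z_{\ge0}\to\{0,1\}$, $k\in\mathbb N$, by $\mathcal W_k(0)=0$ and $$\mathcal W_k(x)=\mathcal W_k(x-1)+\eta(x)(1-\mathcal W_k(x-1))\prod_{\ell=1}^{k-1}\mathcal W_\ell(x-1)-(1-\eta(x))\mathcal W_k(x-1)\prod_{\ell=1}^{k-1}(1-\mathcal W_\ell(x-1)).$$ Put $\eta^\uparrow_k(x)=\mathbf 1_{\{\mathcal W_k(x)>\mathcal W_k(x-1)\}}$, $\eta^\downarrow_k(x)=\mathbf 1_{\{\mathcal W_k(x)<\mathcal W_k(x-1)\}}$. A site $x\in\mathbb N$ is a record if $\eta(x)=0$ and $\mathcal W_k(x-1)=0$ for all $k$. For $\sigma\in\{\uparrow,\downarrow\}$ (empty sums are $0$): $$m^\sigma_k(x)=\sum_{y=1}^x(\eta^\sigma_k(y)-\eta^\sigma_{k+1}(y)),\qquad\xi_k(x)=x-\sum_{\ell=1}^k\sum_{y=1}^x(\eta^\uparrow_\ell(y)+\eta^\downarrow_\ell(y)),$$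 $\tau_k(j)=\min\{x\in\mathbb Z_{\ge0}\ ;\ m^\sigma_k(x)\ge j\text{ for both }\sigma\in\{\uparrow,\downarrow\}\}$ ($\min\emptyset=\infty$), and $\zeta_k(i)=|\{j\in\mathbb N\ ;\ \tau_k(j)\in\{x\in\mathbb Z_{\ge0}\ ;\ \xi_k(x)=i\}\}|$. Takahashi-Satsuma (TS) algorithm for $\eta\in\Omega_{<\infty}$: a run is a maximal string of consecutive equal letters; the configuration is regarded as preceded by infinitely many $0$'s to the left of site $1$ (so the leading run of $0$'s is infinite). While there are uncrossed $1$'s: considering only uncrossed letters, select the leftmost run whose length is at least the length, denoted $k$, of the run preceding it; the first $k$ letters of this run together with the last $k$ letters of the preceding run form a $k$-soliton; cross out these $2k$ letters. A $k$-soliton is thus a set $\gamma=\{z(\gamma)_1<\cdots<z(\gamma)_{2k}\}\subset\mathbb N$ of sites. Every site of $\mathbb N$ is either a record or a component of exactly one soliton. Slot configuration: $\nu:\mathbb N\to\mathbb Z_{\ge0}\cup\{\infty\}$ is $\nu(x)=l-1$ if $x=z(\gamma)_l$ or $x=z(\gamma)_{l+k}$ for some $k$-soliton $\gamma$ of $\eta$ and $1\le l\le k$, and $\nu(x)=\infty$ if $x$ is a record. Put $\tilde\xi_k(0)=0$, $\tilde\xi_k(x)=\sum_{y=1}^x\mathbf 1_{\{\nu(y)\ge k\}}$, $\tilde s_k(i)=\min\{x\in\mathbb Z_{\ge0}\ ;\ \tilde\xi_k(x)=i\}$. Slot decomposition: for $k\in\mathbb N$, $i\in\mathbb Z_{\ge0}$,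 $\tilde\zeta_k(i)$ is the number of $k$-solitons $\gamma$ of $\eta$ with $\gamma\subset[\tilde s_k(i),\tilde s_k(i+1)-1]$. *)

theory Defs
  imports Complex_Main "HOL-Library.Extended_Nat"
begin

text \<open>
  Sites are the positive elements of \<^typ>\<open>nat\<close>; a configuration is a function
  \<^typ>\<open>nat \<Rightarrow> int\<close> whose value at 0 is never inspected. Levels \<open>k\<close> start at 1.
\<close>

definition Omega :: "(nat \<Rightarrow> int) set" where
  "Omega = {\<eta>. \<forall>x\<ge>1. \<eta> x \<in> {0, 1}}"

definition Omega_fin :: "(nat \<Rightarrow> int) set" where
  "Omega_fin = {\<eta> \<in> Omega. summable (\<lambda>n. real_of_int (\<eta> (Suc n)))}"

definition ecard :: "'a set \<Rightarrow> enat" where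
  "ecard A = (if finite A then enat (card A) else \<infinity>)"


section \<open>Seat numbers\<close>

text \<open>\<open>seat \<eta> x k\<close> is the value at \<open>x\<close> of the \<open>k\<close>-th seat indicator (note the argument order).\<close>

primrec seat :: "(nat \<Rightarrow> int) \<Rightarrow> nat \<Rightarrow> nat \<Rightarrow> int" where
  "seat \<eta> 0 = (\<lambda>k. 0)"
| "seat \<eta> (Suc x) = (\<lambda>k. seat \<eta> x k
      + \<eta> (Suc x) * (1 - seat \<eta> x k) * (\<Prod>l\<in>{1..<k}. seat \<eta> x l)
      - (1 - \<eta> (Suc x)) * seat \<eta> x k * (\<Prod>l\<in>{1..<k}. 1 - seat \<eta> x l))"

datatype arrow = Up | Down

fun seat_change :: "(nat \<Rightarrow> int) \<Rightarrow> arrow \<Rightarrow> nat \<Rightarrow> nat \<Rightarrow> int" where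
  "seat_change \<eta> Up k x = of_bool (seat \<eta> x k > seat \<eta> (x - 1) k)"
| "seat_change \<eta> Down k x = of_bool (seat \<eta> x k < seat \<eta> (x - 1) k)"

definition is_record :: "(nat \<Rightarrow> int) \<Rightarrow> nat \<Rightarrow> bool" where
  "is_record \<eta> x \<longleftrightarrow> x \<ge> 1 \<and> \<eta> x = 0 \<and> (\<forall>k\<ge>1. seat \<eta> (x - 1) k = 0)"

definition m :: "(nat \<Rightarrow> int) \<Rightarrow> arrow \<Rightarrow> nat \<Rightarrow> nat \<Rightarrow> int" where
  "m \<eta> \<sigma> k x = (\<Sum>y = 1..x. seat_change \<eta> \<sigma> k y - seat_change \<eta> \<sigma> (k + 1) y)"

definition xi :: "(nat \<Rightarrow> int) \<Rightarrow> nat \<Rightarrow> nat \<Rightarrow> int" where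
  "xi \<eta> k x =
     int x - (\<Sum>l = 1..k. \<Sum>y = 1..x. seat_change \<eta> Up l y + seat_change \<eta> Down l y)"

text \<open>The infimum in \<^typ>\<open>enat\<close> is the minimum, with value \<open>\<infinity>\<close> on the empty set.\<close>

definition tau :: "(nat \<Rightarrow> int) \<Rightarrow> nat \<Rightarrow> nat \<Rightarrow> enat" where
  "tau \<eta> k j = Inf (enat ` {x. \<forall>\<sigma>. m \<eta> \<sigma> k x \<ge> int j})"

definition zeta :: "(nat \<Rightarrow> int) \<Rightarrow> nat \<Rightarrow> nat \<Rightarrow> enat" where
  "zeta \<eta> k i = ecard {j. j \<ge> 1 \<and> tau \<eta> k j \<in> enat ` {x. xi \<eta> k x = int i}}"


section \<open>Takahashi--Satsuma algorithm\<close>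

text \<open>
  The algorithm works on the two-sided configuration obtained by putting zeros on all sites
  \<open>\<le> 0\<close>, so its sites are integers. Its state is the set \<open>U\<close> of uncrossed sites.
\<close>

definition ext :: "(nat \<Rightarrow> int) \<Rightarrow> int \<Rightarrow> int" where
  "ext \<eta> z = (if z \<ge> 1 then \<eta> (nat z) else 0)"

text \<open>Nonempty strings of equal letters that are consecutive among the uncrossed ones.\<close>

definition const_string :: "(nat \<Rightarrow> int) \<Rightarrow> int set \<Rightarrow> int set \<Rightarrow> bool" where
  "const_string \<eta> U R \<longleftrightarrow> R \<noteq> {} \<and> R \<subseteq> U \<and>
     (\<forall>a\<in>R. \<forall>b\<in>R. {a..b} \<inter> U \<subseteq> R \<and> ext \<eta> a = ext \<eta> b)"

definition is_run :: "(nat \<Rightarrow> int) \<Rightarrow> int set \<Rightarrow> int set \<Rightarrow> bool" where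
  "is_run \<eta> U R \<longleftrightarrow> const_string \<eta> U R \<and> (\<forall>R'. const_string \<eta> U R' \<and> R \<subseteq> R' \<longrightarrow> R' = R)"

definition left_of :: "int set \<Rightarrow> int set \<Rightarrow> bool" where
  "left_of P R \<longleftrightarrow> (\<forall>p\<in>P. \<forall>r\<in>R. p < r)"

definition preceding_run :: "(nat \<Rightarrow> int) \<Rightarrow> int set \<Rightarrow> int set \<Rightarrow> int set \<Rightarrow> bool" where
  "preceding_run \<eta> U P R \<longleftrightarrow> is_run \<eta> U P \<and> is_run \<eta> U R \<and> left_of P R \<and>
     \<not> (\<exists>c\<in>U. left_of P {c} \<and> left_of {c} R)"

text \<open>\<open>P\<close> is the run preceding \<open>R\<close> and \<open>R\<close> is at least as long as \<open>P\<close>.\<close>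

definition eligible :: "(nat \<Rightarrow> int) \<Rightarrow> int set \<Rightarrow> int set \<Rightarrow> int set \<Rightarrow> bool" where
  "eligible \<eta> U P R \<longleftrightarrow> preceding_run \<eta> U P R \<and> ecard P \<le> ecard R"

definition selected :: "(nat \<Rightarrow> int) \<Rightarrow> int set \<Rightarrow> int set \<Rightarrow> int set \<Rightarrow> bool" where
  "selected \<eta> U P R \<longleftrightarrow> eligible \<eta> U P R \<and>
     (\<forall>P' R'. eligible \<eta> U P' R' \<longrightarrow> R' = R \<or> left_of R R')"

definition first_letters :: "nat \<Rightarrow> int set \<Rightarrow> int set" where
  "first_letters k R = {r \<in> R. ecard {s \<in> R. s < r} < enat k}"

definition last_letters :: "nat \<Rightarrow> int set \<Rightarrow> int set" where
  "last_letters k P = {p \<in> P. ecard {q \<in> P. p < q} < enat k}"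

definition ts_step :: "(nat \<Rightarrow> int) \<Rightarrow> int set \<Rightarrow> nat \<Rightarrow> int set \<Rightarrow> bool" where
  "ts_step \<eta> U k C \<longleftrightarrow> (\<exists>z\<in>U. ext \<eta> z = 1) \<and>
     (\<exists>P R. selected \<eta> U P R \<and> ecard P = enat k \<and> C = first_letters k R \<union> last_letters k P)"

inductive ts_state :: "(nat \<Rightarrow> int) \<Rightarrow> int set \<Rightarrow> bool" for \<eta> where
  start: "ts_state \<eta> UNIV"
| cross: "ts_state \<eta> U \<Longrightarrow> ts_step \<eta> U k C \<Longrightarrow> ts_state \<eta> (U - C)"

text \<open>
  The infinite leading run is never preceded by a run, and it cannot precede a selected run while
  some 1 is uncrossed; hence all crossed sites are positive and solitons are sets of naturals.
\<close>

definition soliton :: "(nat \<Rightarrow> int) \<Rightarrow> nat \<Rightarrow> nat set \<Rightarrow> bool" where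
  "soliton \<eta> k \<gamma> \<longleftrightarrow> (\<exists>U. ts_state \<eta> U \<and> ts_step \<eta> U k (int ` \<gamma>))"

definition component :: "nat set \<Rightarrow> nat \<Rightarrow> nat" where
  "component \<gamma> l = sorted_list_of_set \<gamma> ! (l - 1)"


section \<open>Slot decomposition\<close>

text \<open>
  Each site is either a record or a component of exactly one soliton, so the description below
  determines the value uniquely for \<open>\<eta> \<in> Omega_fin\<close> and \<open>x \<ge> 1\<close>.
\<close>

definition slot :: "(nat \<Rightarrow> int) \<Rightarrow> nat \<Rightarrow> enat" where
  "slot \<eta> x = (THE v.
     (\<exists>k \<gamma> l. soliton \<eta> k \<gamma> \<and> 1 \<le> l \<and> l \<le> k \<and>
        (x = component \<gamma> l \<or> x = component \<gamma> (l + k)) \<and> v = enat (l - 1)) \<or>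
     (is_record \<eta> x \<and> v = \<infinity>))"

definition xi_slot :: "(nat \<Rightarrow> int) \<Rightarrow> nat \<Rightarrow> nat \<Rightarrow> int" where
  "xi_slot \<eta> k x = (\<Sum>y = 1..x. of_bool (slot \<eta> y \<ge> enat k))"

text \<open>
  For \<open>\<eta> \<in> Omega_fin\<close> the minimum is attained: all but finitely many sites are records, so
  \<open>xi_slot \<eta> k\<close> starts at 0, increases by steps of at most 1 and is unbounded.
\<close>

definition s_slot :: "(nat \<Rightarrow> int) \<Rightarrow> nat \<Rightarrow> nat \<Rightarrow> nat" where
  "s_slot \<eta> k i = (LEAST x. xi_slot \<eta> k x = int i)"

definition zeta_slot :: "(nat \<Rightarrow> int) \<Rightarrow> nat \<Rightarrow> nat \<Rightarrow> enat" where
  "zeta_slot \<eta> k i =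
     ecard {\<gamma>. soliton \<eta> k \<gamma> \<and> \<gamma> \<subseteq> {s_slot \<eta> k i .. s_slot \<eta> k (i + 1) - 1}}"

end

theory Submission
  imports Defs
begin

text \<open>
  Read the sites from left to right and keep the uncrossed letters as a stack of alternating runs on
  top of an infinite run of zeros; a soliton is crossed out as soon as the top run becomes as long as
  the run below it, so the lengths strictly decrease towards the top. A letter that becomes the
  \<open>k\<close>-th letter of its run changes exactly the \<open>k\<close>-th seat, because the \<open>k\<close>-th seat holds the letter of
  the topmost run of length at least \<open>k\<close>. The solitons completed in this reading are those selected
  by the Takahashi--Satsuma algorithm, in the same order, and \<open>\<tau>\<^sub>k(j)\<close> is the site completing the \<open>j\<close>-th
  \<open>k\<close>-soliton. Between the first and the last site of a \<open>k\<close>-soliton there is no letter of rank above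
  \<open>k\<close> in its run, so \<open>\<xi>\<^sub>k\<close> is constant there.
\<close>

section \<open>Runs and seat numbers\<close>

text \<open>The algorithm sees the whole configuration, the stack only what has been read, so the
  selected run may be longer than the top run of the stack. This does no harm: unread letters
  adjacent to the stack can only prolong its top run, a step crosses just the first \<open>k\<close>
  letters of that run, and every stored run below the top is strictly shorter than its predecessor,
  hence not eligible.

  The condition in \<open>tau\<close> on both arrows counts solitons for the following reason.
  \<open>m\<close> exceeds the number of completed \<open>k\<close>-solitons by the number of stack
  runs of length exactly \<open>k\<close> that carry the letter of the arrow. As lengths strictly
  decrease, there is at most one such run, so for at least one arrow the excess vanishes.

  Both decompositions then count the same set: the sites that complete a \<open>k\<close>-soliton
  and at which \<open>xi \<eta> k\<close> has the value \<open>i\<close>.\<close>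

text \<open>
  A stack lists the runs above the infinite run of zeros, topmost run first and, within a run, latest
  site first. The letter of a run is the parity of its height, so the letter at \<open>x\<close> prolongs the top
  run iff the first condition holds; records join the infinite run, which is not stored.
\<close>

definition grow :: "(nat \<Rightarrow> int) \<Rightarrow> nat \<Rightarrow> nat list list \<Rightarrow> nat list list" where
  "grow \<eta> x S =
     (if odd (length S) \<longleftrightarrow> \<eta> x = 1 then (case S of [] \<Rightarrow> [] | R # S' \<Rightarrow> (x # R) # S') else [x] # S)"

fun cancel :: "nat list list \<Rightarrow> nat list list" where
  "cancel (R # P # S) = (if length R = length P then S else R # P # S)"
| "cancel S = S"

primrec run_stack :: "(nat \<Rightarrow> int) \<Rightarrow> nat \<Rightarrow> nat list list" where
  "run_stack \<eta> 0 = []"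
| "run_stack \<eta> (Suc x) = cancel (grow \<eta> (Suc x) (run_stack \<eta> x))"

definition grown :: "(nat \<Rightarrow> int) \<Rightarrow> nat \<Rightarrow> nat list list" where
  "grown \<eta> x = grow \<eta> x (run_stack \<eta> (x - 1))"

text \<open>The rank of \<open>x\<close> in its run when it is read; 0 for records.\<close>

definition level :: "(nat \<Rightarrow> int) \<Rightarrow> nat \<Rightarrow> nat" where
  "level \<eta> x = (case grown \<eta> x of [] \<Rightarrow> 0 | R # _ \<Rightarrow> length R)"

definition completed :: "(nat \<Rightarrow> int) \<Rightarrow> nat \<Rightarrow> nat set \<Rightarrow> nat \<Rightarrow> bool" where
  "completed \<eta> k \<gamma> x \<longleftrightarrow> x \<ge> 1 \<and>
     (\<exists>R P S. grown \<eta> x = R # P # S \<and> length R = k \<and> length P = k \<and> \<gamma> = set R \<union> set P)"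

section \<open>Invariants of the stack of runs\<close>

text \<open>The last two clauses serve the end of the proof. Levels count up from the earliest site
  of a run, which turns ranks into slots; and no level since that site exceeds the length of the
  run, which keeps \<open>xi\<close> constant along a soliton.\<close>

definition wf_runs :: "(nat \<Rightarrow> int) \<Rightarrow> nat \<Rightarrow> nat list list \<Rightarrow> bool" where
  "wf_runs \<eta> x S \<longleftrightarrow>
     sorted_wrt (\<lambda>Q Q'. \<forall>a\<in>set Q. \<forall>b\<in>set Q'. b < a) S \<and>
     (\<forall>i<length S. \<forall>y\<in>set (S ! i). \<eta> y = of_bool (odd (length S - i))) \<and>
     (\<forall>Q\<in>set S. Q \<noteq> [] \<and> sorted_wrt (>) Q \<and> set Q \<subseteq> {1..x} \<and>
        map (level \<eta>) (rev Q) = [1..<Suc (length Q)] \<and>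
        (\<forall>y\<in>{last Q..x}. level \<eta> y \<le> length Q))"

lemma run_stack_Suc: "run_stack \<eta> (Suc x) = cancel (grown \<eta> (Suc x))"
  by (simp add: grown_def)

lemma wf_runs_Nil [simp]: "wf_runs \<eta> x []"
  by (simp add: wf_runs_def)

lemma wf_runs_Cons:
  "wf_runs \<eta> x (R # S) \<longleftrightarrow>
     (\<forall>Q\<in>set S. \<forall>a\<in>set R. \<forall>b\<in>set Q. b < a) \<and>
     (\<forall>y\<in>set R. \<eta> y = of_bool (even (length S))) \<and>
     R \<noteq> [] \<and> sorted_wrt (>) R \<and> set R \<subseteq> {1..x} \<and>
     map (level \<eta>) (rev R) = [1..<Suc (length R)] \<and>
     (\<forall>y\<in>{last R..x}. level \<eta> y \<le> length R) \<and> wf_runs \<eta> x S"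
  by (auto simp: wf_runs_def All_less_Suc2)

lemma wf_runs_nonempty: "wf_runs \<eta> x S \<Longrightarrow> \<forall>Q\<in>set S. Q \<noteq> []"
  by (simp add: wf_runs_def)

lemma wf_runs_cancel: "wf_runs \<eta> x S \<Longrightarrow> wf_runs \<eta> x (cancel S)"
  by (cases S rule: cancel.cases) (auto simp: wf_runs_Cons)

definition strict_runs :: "nat list list \<Rightarrow> bool" where
  "strict_runs S \<longleftrightarrow> sorted_wrt (\<lambda>Q Q'. length Q < length Q') S"

lemma strict_runs_simps [simp]:
  "strict_runs []"
  "strict_runs (R # S) \<longleftrightarrow> (\<forall>Q\<in>set S. length R < length Q) \<and> strict_runs S"
  by (auto simp: strict_runs_def)

text \<open>The state between reading a letter and cancelling: only the top run may tie with the one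
  below it.\<close>

definition weak_runs :: "nat list list \<Rightarrow> bool" where
  "weak_runs S \<longleftrightarrow> (\<forall>Q\<in>set (tl S). length (hd S) \<le> length Q) \<and> strict_runs (tl S)"

text \<open>One cancellation is enough: on a tie the remaining runs are already strict, and without
  a tie the top run is strictly shorter than the second, hence than all others.\<close>

lemma strict_runs_cancel: "weak_runs S \<Longrightarrow> strict_runs (cancel S)"
  by (cases S rule: cancel.cases) (fastforce simp: weak_runs_def)+

lemma weak_runs_grow:
  assumes "strict_runs S" "\<forall>Q\<in>set S. Q \<noteq> []"
  shows "weak_runs (grow \<eta> x S)"
  using assms by (auto simp: weak_runs_def grow_def Suc_le_eq split: list.splits)

text \<open>Runs alternate upwards from zeros, so this parity is the letter of the topmost run of length at least \<open>k\<close>.\<close>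

definition seat_of :: "nat list list \<Rightarrow> nat \<Rightarrow> bool" where
  "seat_of S k = odd (length (filter (\<lambda>R. k \<le> length R) S))"

text \<open>The two cancelled runs have equal length, so both or neither are counted and the parity
  is kept.\<close>

lemma seat_of_cancel: "seat_of (cancel S) k = seat_of S k"
  by (cases S rule: cancel.cases) (auto simp: seat_of_def)

locale configuration =
  fixes \<eta> :: "nat \<Rightarrow> int"
  assumes binary: "x \<ge> 1 \<Longrightarrow> \<eta> x = 0 \<or> \<eta> x = 1"
begin

lemma level_Suc: "level \<eta> (Suc x) = (case grow \<eta> (Suc x) (run_stack \<eta> x) of [] \<Rightarrow> 0 | R # _ \<Rightarrow> length R)"
  by (simp add: level_def grown_def)

text \<open>The level of the new letter is the length of the grown top run, which is at most the
  length of every run below; this maintains the level bound for all old runs at once.\<close>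

lemma wf_runs_grow:
  assumes S: "S = run_stack \<eta> x" and wf: "wf_runs \<eta> x S" and strict: "strict_runs S"
  shows "wf_runs \<eta> (Suc x) (grow \<eta> (Suc x) S)"
proof -
  have lev: "level \<eta> (Suc x) = (case grow \<eta> (Suc x) S of [] \<Rightarrow> 0 | R # _ \<Rightarrow> length R)"
    by (simp add: level_Suc S)
  have "weak_runs (grow \<eta> (Suc x) S)"
    using weak_runs_grow strict wf by (simp add: wf_runs_def)
  then have lev_le: "level \<eta> (Suc x) \<le> length Q" if "Q \<in> set (grow \<eta> (Suc x) S)" for Q
    using that lev by (cases "grow \<eta> (Suc x) S") (auto simp: weak_runs_def)
  have old: "wf_runs \<eta> (Suc x) T"
    if "wf_runs \<eta> x T" "set T \<subseteq> set (grow \<eta> (Suc x) S)" for T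
  proof -
    have "level \<eta> y \<le> length Q" if "Q \<in> set T" "y \<in> {last Q..Suc x}" for Q y
      using that \<open>wf_runs \<eta> x T\<close> \<open>set T \<subseteq> _\<close> lev_le by (cases "y = Suc x") (auto simp: wf_runs_def)
    moreover have "set Q \<subseteq> {1..Suc x}" if "Q \<in> set T" for Q
      using that \<open>wf_runs \<eta> x T\<close> by (fastforce simp: wf_runs_def)
    ultimately show ?thesis using \<open>wf_runs \<eta> x T\<close> by (auto simp: wf_runs_def)
  qed
  have below: "b < Suc x" if "Q \<in> set S" "b \<in> set Q" for Q b
    using that wf by (fastforce simp: wf_runs_def)
  show ?thesis
  proof (cases "odd (length S) \<longleftrightarrow> \<eta> (Suc x) = 1")
    case True
    show ?thesis
    proof (cases S)
      case Nil
      then show ?thesis using True by (simp add: grow_def)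
    next
      case (Cons R S')
      have G: "grow \<eta> (Suc x) S = (Suc x # R) # S'"
        using True Cons by (simp add: grow_def)
      have levR: "level \<eta> (Suc x) = Suc (length R)" by (simp add: lev G)
      have "\<eta> (Suc x) = of_bool (even (length S'))"
        using True Cons binary[of "Suc x"] by auto
      moreover have "level \<eta> y \<le> Suc (length R)" if "y \<in> {last R..Suc x}" for y
        using that wf Cons levR by (cases "y = Suc x") (auto simp: wf_runs_Cons le_SucI)
      moreover have "set R \<subseteq> {1..Suc x}" using wf Cons by (fastforce simp: wf_runs_Cons)
      moreover have "wf_runs \<eta> x S'" using wf Cons by (simp add: wf_runs_Cons)
      from old[OF this] have "wf_runs \<eta> (Suc x) S'" by (auto simp: G)
      ultimately show ?thesis
        using wf levR below unfolding G by (auto simp: Cons wf_runs_Cons)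
    qed
  next
    case False
    then have "\<eta> (Suc x) = of_bool (even (length S))" using binary[of "Suc x"] by auto
    then show ?thesis
      using False old[OF wf] lev below by (auto simp: grow_def wf_runs_Cons)
  qed
qed

lemma run_stack_wf: "wf_runs \<eta> x (run_stack \<eta> x) \<and> strict_runs (run_stack \<eta> x)"
proof (induction x)
  case (Suc x)
  then have "weak_runs (grow \<eta> (Suc x) (run_stack \<eta> x))"
    using weak_runs_grow wf_runs_nonempty by blast
  then show ?case
    using Suc wf_runs_grow[of _ x] by (simp add: wf_runs_cancel strict_runs_cancel)
qed simp

lemma grown_wf:
  assumes "x \<ge> 1"
  shows "wf_runs \<eta> x (grown \<eta> x)" "weak_runs (grown \<eta> x)"
proof -
  obtain y where x: "x = Suc y" using assms by (cases x) auto
  show "wf_runs \<eta> x (grown \<eta> x)"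
    using wf_runs_grow run_stack_wf by (simp add: grown_def x)
  show "weak_runs (grown \<eta> x)"
    using weak_runs_grow run_stack_wf wf_runs_nonempty by (metis grown_def)
qed

section \<open>Seat numbers read off the stack\<close>

text \<open>Growth alters the number of runs of length at least \<open>k\<close> only when the top
  run reaches length \<open>k\<close>, and then by one.\<close>

lemma seat_of_grow:
  assumes S: "S = run_stack \<eta> x" and k: "k \<ge> 1"
  shows "seat_of (grow \<eta> (Suc x) S) k = (seat_of S k \<noteq> (level \<eta> (Suc x) = k))"
proof -
  have "\<forall>Q\<in>set S. Q \<noteq> []" using S run_stack_wf wf_runs_nonempty by blast
  then show ?thesis
    using k by (auto simp: level_Suc S[symmetric] grow_def seat_of_def Suc_le_eq split: list.splits)
qed

text \<open>The level is the first seat that disagrees with the letter. Seats up to the length of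
  the top run hold its letter, the next one holds the opposite letter of the run below. A letter
  that opens a new run already disagrees with seat 1, and a record agrees with all seats.\<close>

lemma level_seat_of:
  assumes S: "S = run_stack \<eta> x" and k: "k \<ge> 1"
  shows "level \<eta> (Suc x) = k \<longleftrightarrow>
    seat_of S k \<noteq> (\<eta> (Suc x) = 1) \<and> (\<forall>l\<in>{1..<k}. seat_of S l = (\<eta> (Suc x) = 1))"
proof -
  have wf: "wf_runs \<eta> x S" "strict_runs S" using run_stack_wf S by auto
  \<comment> \<open>The first disagreeing seat is unique, so it suffices below to exhibit
    one.\<close>
  have unique: "k = l" if "P k" "l \<ge> 1" "P l"
    "\<And>l. P l \<longleftrightarrow> seat_of S l \<noteq> (\<eta> (Suc x) = 1) \<and> (\<forall>i\<in>{1..<l}. seat_of S i = (\<eta> (Suc x) = 1))" for P l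
    using that k by (metis atLeastLessThan_iff linorder_neqE_nat)
  show ?thesis
  proof (cases "odd (length S) \<longleftrightarrow> \<eta> (Suc x) = 1")
    case True
    show ?thesis
    proof (cases S)
      case Nil
      then show ?thesis using True k
        by (simp add: level_Suc S[symmetric] grow_def seat_of_def)
    next
      case (Cons R S')
      have "level \<eta> (Suc x) = Suc (length R)"
        using True Cons by (simp add: level_Suc S[symmetric] grow_def)
      moreover have "filter (\<lambda>R. l \<le> length R) S = S" if "l \<le> length R" for l
        using that wf(2) Cons by (auto simp: filter_id_conv)
      then have "seat_of S l = (\<eta> (Suc x) = 1)" if "l \<le> length R" for l
        using True that by (simp add: seat_of_def)
      moreover have "filter (\<lambda>Q. Suc (length R) \<le> length Q) S = S'"
        using wf(2) Cons by (auto simp: filter_id_conv)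
      then have "seat_of S (Suc (length R)) \<noteq> (\<eta> (Suc x) = 1)"
        using True Cons by (simp add: seat_of_def)
      ultimately show ?thesis
        using unique[of "\<lambda>l. seat_of S l \<noteq> (\<eta> (Suc x) = 1) \<and> (\<forall>i\<in>{1..<l}. seat_of S i = (\<eta> (Suc x) = 1))" "Suc (length R)"]
        by auto
    qed
  next
    case False
    have "level \<eta> (Suc x) = 1" using False by (simp add: level_Suc S[symmetric] grow_def)
    moreover have "filter (\<lambda>R. 1 \<le> length R) S = S"
      using wf(1) by (auto simp: filter_id_conv wf_runs_def Suc_le_eq)
    then have "seat_of S 1 \<noteq> (\<eta> (Suc x) = 1)" using False by (simp add: seat_of_def)
    ultimately show ?thesis
      using unique[of "\<lambda>l. seat_of S l \<noteq> (\<eta> (Suc x) = 1) \<and> (\<forall>i\<in>{1..<l}. seat_of S i = (\<eta> (Suc x) = 1))" 1]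
      by auto
  qed
qed

text \<open>Each product is the indicator that all lower seats agree with the letter it is
  multiplied with, so the recursion flips seat \<open>k\<close> exactly when the level is
  \<open>k\<close>.\<close>

lemma seat_eq: "k \<ge> 1 \<Longrightarrow> seat \<eta> x k = of_bool (seat_of (run_stack \<eta> x) k)"
proof (induction x arbitrary: k)
  case 0
  then show ?case by (simp add: seat_of_def)
next
  case (Suc x)
  let ?S = "run_stack \<eta> x" and ?a = "\<eta> (Suc x) = 1"
  have IH: "seat \<eta> x l = of_bool (seat_of ?S l)" if "l \<ge> 1" for l
    using Suc.IH that .
  have up: "(\<Prod>l\<in>{1..<k}. seat \<eta> x l) = of_bool (\<forall>l\<in>{1..<k}. seat_of ?S l)"
  proof (cases "\<forall>l\<in>{1..<k}. seat_of ?S l")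
    case False
    then show ?thesis by (auto simp: IH intro!: prod_zero)
  qed (simp add: IH)
  have down: "(\<Prod>l\<in>{1..<k}. 1 - seat \<eta> x l) = of_bool (\<forall>l\<in>{1..<k}. \<not> seat_of ?S l)"
  proof (cases "\<forall>l\<in>{1..<k}. \<not> seat_of ?S l")
    case False
    then show ?thesis by (auto simp: IH intro!: prod_zero)
  qed (simp add: IH)
  have "seat_of (run_stack \<eta> (Suc x)) k = (seat_of ?S k \<noteq> (level \<eta> (Suc x) = k))"
    using seat_of_grow Suc.prems by (simp add: seat_of_cancel)
  also have "level \<eta> (Suc x) = k \<longleftrightarrow> seat_of ?S k \<noteq> ?a \<and> (\<forall>l\<in>{1..<k}. seat_of ?S l = ?a)"
    using level_seat_of Suc.prems by blast
  finally show ?case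
    using binary[of "Suc x"] Suc.prems by (auto simp: up down IH)
qed

lemma seat_change_eq:
  assumes "k \<ge> 1" "x \<ge> 1"
  shows "seat_change \<eta> Up k x = of_bool (level \<eta> x = k \<and> \<eta> x = 1)"
    "seat_change \<eta> Down k x = of_bool (level \<eta> x = k \<and> \<eta> x = 0)"
proof -
  obtain y where x: "x = Suc y" using assms by (cases x) auto
  let ?S = "run_stack \<eta> y"
  have "seat \<eta> y k = of_bool (seat_of ?S k)"
    "seat \<eta> x k = of_bool (seat_of ?S k \<noteq> (level \<eta> x = k))"
    using seat_of_grow assms seat_eq by (simp_all add: seat_of_cancel x del: seat.simps)
  moreover have "level \<eta> x = k \<Longrightarrow> seat_of ?S k \<longleftrightarrow> \<eta> x = 0"
    using level_seat_of[of ?S y k] assms binary[of x] by (auto simp: x)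
  ultimately show "seat_change \<eta> Up k x = of_bool (level \<eta> x = k \<and> \<eta> x = 1)"
    "seat_change \<eta> Down k x = of_bool (level \<eta> x = k \<and> \<eta> x = 0)"
    using binary[of x] assms by (auto simp: x simp del: seat.simps)
qed

lemma is_record_iff:
  assumes "x \<ge> 1"
  shows "is_record \<eta> x \<longleftrightarrow> level \<eta> x = 0"
proof
  assume rec: "is_record \<eta> x"
  show "level \<eta> x = 0"
  proof (rule ccontr)
    assume "level \<eta> x \<noteq> 0"
    moreover from rec have "\<eta> x = 0" by (simp add: is_record_def)
    ultimately have "seat_change \<eta> Down (level \<eta> x) x = 1"
      using seat_change_eq(2) assms by simp
    moreover have "seat \<eta> (x - 1) (level \<eta> x) = 0"
      using rec \<open>level \<eta> x \<noteq> 0\<close> by (simp add: is_record_def)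
    \<comment> \<open>A record of positive level would push an empty seat below 0.\<close>
    ultimately have "seat \<eta> x (level \<eta> x) < 0" by (auto split: if_splits)
    then show False
      using seat_eq[of "level \<eta> x" x] \<open>level \<eta> x \<noteq> 0\<close> by (simp add: of_bool_def split: if_splits)
  qed
next
  assume lev: "level \<eta> x = 0"
  obtain y where x: "x = Suc y" using assms by (cases x) auto
  have "run_stack \<eta> y = [] \<and> \<eta> x = 0"
    using lev binary[of x] by (auto simp: x level_Suc grow_def split: if_splits list.splits)
  then show "is_record \<eta> x"
    by (simp add: is_record_def x seat_eq seat_of_def)
qed

end

section \<open>Runs of the Takahashi--Satsuma algorithm\<close>

text \<open>The union of two runs with a common site is again a constant string, so both equal it by
  maximality.\<close>

lemma is_run_inter:
  assumes R: "is_run \<eta> U R" and R': "is_run \<eta> U R'" and z: "z \<in> R" "z \<in> R'"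
  shows "R = R'"
proof -
  have c: "const_string \<eta> U R" "const_string \<eta> U R'" using R R' by (auto simp: is_run_def)
  have join: "{a..b} \<inter> U \<subseteq> R \<union> R'" if "a \<in> R \<union> R'" "b \<in> R \<union> R'" for a b
  proof
    fix w assume w: "w \<in> {a..b} \<inter> U"
    show "w \<in> R \<union> R'"
    proof (cases "w \<le> z")
      case True
      then have "w \<in> {a..z} \<inter> U" using w by auto
      then show ?thesis using that z c unfolding const_string_def by blast
    next
      case False
      then have "w \<in> {z..b} \<inter> U" using w by auto
      then show ?thesis using that z c unfolding const_string_def by blast
    qed
  qed
  have "ext \<eta> a = ext \<eta> z" if "a \<in> R \<union> R'" for a
    using that z c unfolding const_string_def by blast
  then have letters: "ext \<eta> a = ext \<eta> b" if "a \<in> R \<union> R'" "b \<in> R \<union> R'" for a b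
    using that by simp
  have "R \<union> R' \<noteq> {}" "R \<union> R' \<subseteq> U" using c unfolding const_string_def by auto
  then have "const_string \<eta> U (R \<union> R')"
    unfolding const_string_def using join letters by blast
  then have "R \<union> R' = R" "R \<union> R' = R'"
    using R R' unfolding is_run_def by blast+
  then show ?thesis by simp
qed

lemma is_run_nonempty: "is_run \<eta> U R \<Longrightarrow> R \<noteq> {}"
  by (simp add: is_run_def const_string_def)

lemma const_string_convex:
  assumes "const_string \<eta> U R" "a \<in> R" "b \<in> R" "a \<le> w" "w \<le> b" "w \<in> U"
  shows "w \<in> R"
proof -
  have "{a..b} \<inter> U \<subseteq> R" using assms(1-3) unfolding const_string_def by blast
  then show ?thesis using assms(4-6) by auto
qed

lemma is_run_subset: "is_run \<eta> U R \<Longrightarrow> R \<subseteq> U"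
  by (simp add: is_run_def const_string_def)

text \<open>Of two disjoint runs just before \<open>R\<close>, one has a site to the right of the
  other; that site lies in the gap before \<open>R\<close>, where no uncrossed site is
  allowed.\<close>

lemma preceding_run_unique:
  assumes "preceding_run \<eta> U P R" "preceding_run \<eta> U P' R"
  shows "P = P'"
proof -
  have *: False if p: "preceding_run \<eta> U P R" "preceding_run \<eta> U P' R" "p \<in> P" "p' \<in> P'" "p < p'"
    "P \<inter> P' = {}" for P P' p p'
  proof -
    have runs: "is_run \<eta> U P" "is_run \<eta> U P'" using p(1,2) by (simp_all add: preceding_run_def)
    have "p' \<in> U" using is_run_subset[OF runs(2)] p(4) by blast
    moreover have "q < p'" if "q \<in> P" for q
    proof (rule ccontr)
      assume "\<not> q < p'"
      then have "p' \<in> P"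
        using const_string_convex[of \<eta> U P p q p'] runs(1) p(3,5) that \<open>p' \<in> U\<close>
        by (simp add: is_run_def)
      then show False using p(4,6) by blast
    qed
    moreover have "left_of {p'} R" using p(2,4) by (simp add: preceding_run_def left_of_def)
    ultimately show False using p(1) unfolding preceding_run_def left_of_def by blast
  qed
  have runs: "is_run \<eta> U P" "is_run \<eta> U P'" using assms by (auto simp: preceding_run_def)
  then obtain p p' where pp: "p \<in> P" "p' \<in> P'" using is_run_nonempty by blast
  show ?thesis
  proof (rule ccontr)
    assume "P \<noteq> P'"
    then have "P \<inter> P' = {}" using runs is_run_inter by blast
    moreover from this have "p \<noteq> p'" using pp by auto
    ultimately show False
      using *[OF assms(1,2) pp] *[OF assms(2,1) pp(2,1)]
      by (metis Int_commute linorder_neqE)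
  qed
qed

lemma selected_unique:
  assumes "selected \<eta> U P R" "selected \<eta> U P' R'"
  shows "P = P' \<and> R = R'"
proof -
  have pre: "preceding_run \<eta> U P R" "preceding_run \<eta> U P' R'"
    using assms by (simp_all add: selected_def eligible_def)
  then have "R \<noteq> {}" "R' \<noteq> {}" using is_run_nonempty by (auto simp: preceding_run_def)
  then obtain r r' where rr: "r \<in> R" "r' \<in> R'" by blast
  have "R' = R \<or> left_of R R'" "R = R' \<or> left_of R' R"
    using assms unfolding selected_def by blast+
  then have "R = R'" using rr by (force simp: left_of_def)
  then show ?thesis using pre preceding_run_unique by blast
qed

text \<open>The algorithm is deterministic, so exhibiting one step in a state identifies every step
  from it.\<close>

lemma ts_step_unique: "ts_step \<eta> U k C \<Longrightarrow> ts_step \<eta> U k' C' \<Longrightarrow> k = k' \<and> C = C'"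
  unfolding ts_step_def using selected_unique by (metis enat.inject)

text \<open>\<open>A 0, ..., A n\<close> are the leftmost uncrossed runs, and \<open>Z\<close> is what remains to their right.\<close>

locale run_chain =
  fixes \<eta> :: "nat \<Rightarrow> int" and U :: "int set" and A :: "nat \<Rightarrow> int set" and n :: nat and Z :: "int set"
  assumes U_eq: "U = (\<Union>i\<le>n. A i) \<union> Z"
    and nonempty: "i \<le> n \<Longrightarrow> A i \<noteq> {}"
    and ordered: "i < j \<Longrightarrow> j \<le> n \<Longrightarrow> left_of (A i) (A j)"
    and right: "i \<le> n \<Longrightarrow> left_of (A i) Z"
    and letters: "i \<le> n \<Longrightarrow> z \<in> A i \<Longrightarrow> ext \<eta> z = of_bool (odd i)"
    and maximal: "z \<in> Z \<Longrightarrow> \<exists>w\<in>Z. w \<le> z \<and> ext \<eta> w \<noteq> of_bool (odd n)"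
begin

section \<open>Runs, predecessors and selection in a chain\<close>

lemma U_cases:
  assumes "z \<in> U" "i \<le> n"
  obtains (less) j where "j < i" "z \<in> A j" | (eq) "z \<in> A i" | (greater) j where "i < j" "j \<le> n" "z \<in> A j"
  | (rest) "z \<in> Z"
  using assms by (metis U_eq UN_E Un_iff atMost_iff linorder_neqE_nat)

text \<open>A constant string that leaves \<open>A i\<close> has to pass through a neighbouring
  block, whose letter is opposite; to the right of \<open>A n\<close> the assumption
  \<open>maximal\<close> supplies the opposite letter.\<close>

lemma is_run:
  assumes i: "i \<le> n"
  shows "is_run \<eta> U (A i)"
  unfolding is_run_def
proof (intro conjI allI impI)
  have "{a..b} \<inter> U \<subseteq> A i" if "a \<in> A i" "b \<in> A i" for a b
  proof
    fix w assume w: "w \<in> {a..b} \<inter> U"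
    then have "w \<in> U" by simp
    then show "w \<in> A i" using i
    proof (cases rule: U_cases)
      case (less j) with w that i ordered[of j i] show ?thesis by (fastforce simp: left_of_def)
    next
      case (greater j) with w that i ordered[of i j] show ?thesis by (fastforce simp: left_of_def)
    next
      case rest with w that i right[of i] show ?thesis by (fastforce simp: left_of_def)
    qed
  qed
  then show "const_string \<eta> U (A i)"
    using i nonempty letters U_eq unfolding const_string_def by (auto; metis)
next
  fix R' assume R': "const_string \<eta> U R' \<and> A i \<subseteq> R'"
  then have R'_const: "const_string \<eta> U R'" by blast
  note conv = const_string_convex[OF R'_const]
  have sub: "R' \<subseteq> U" using R'_const by (simp add: const_string_def)
  have same: "ext \<eta> a = ext \<eta> b" if "a \<in> R'" "b \<in> R'" for a b
    using R'_const that unfolding const_string_def by blast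
  obtain a where a: "a \<in> A i" using nonempty i by blast
  then have aR': "a \<in> R'" using R' by blast
  have clash: False if "w \<in> R'" "ext \<eta> w \<noteq> of_bool (odd i)" for w
    using same[OF that(1) aR'] letters[OF i a] that by simp
  have "z \<in> A i" if z: "z \<in> R'" for z
  proof -
    have "z \<in> U" using z sub by blast
    then show ?thesis using i
    proof (cases rule: U_cases)
      case (less j)
      obtain w where w: "w \<in> A (i - 1)" "z \<le> w"
        using nonempty[of "i - 1"] ordered[of j "i - 1"] less i
        by (cases "j = i - 1") (auto simp: left_of_def less_imp_le)
      have "w < a" using ordered[of "i - 1" i] w a less i by (auto simp: left_of_def)
      have "w \<in> U" using w less i U_eq by auto
      then have "w \<in> R'" using conv[OF z aR'] w \<open>w < a\<close> by simp
      moreover have "ext \<eta> w \<noteq> of_bool (odd i)"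
        using letters[of "i - 1" w] w less i by (cases i) auto
      ultimately show ?thesis using clash by blast
    next
      case (greater j)
      obtain w where w: "w \<in> A (Suc i)" "w \<le> z"
        using nonempty[of "Suc i"] ordered[of "Suc i" j] greater i
        by (cases "j = Suc i") (auto simp: left_of_def less_imp_le)
      have "a < w" using ordered[of i "Suc i"] w a greater i by (auto simp: left_of_def)
      have "w \<in> U" using w greater i U_eq by auto
      then have "w \<in> R'" using conv[OF aR' z] w \<open>a < w\<close> by simp
      moreover have "ext \<eta> w \<noteq> of_bool (odd i)"
        using letters[of "Suc i" w] w greater i by auto
      ultimately show ?thesis using clash by blast
    next
      case rest
      obtain w where w: "w \<in> U" "a < w" "w \<le> z" "ext \<eta> w \<noteq> of_bool (odd i)"
      proof (cases "i = n")
        case True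
        obtain w where "w \<in> Z" "w \<le> z" "ext \<eta> w \<noteq> of_bool (odd n)" using maximal rest by blast
        then show ?thesis using that True right[OF i] a U_eq by (auto simp: left_of_def)
      next
        case False
        then have i': "Suc i \<le> n" using i by simp
        obtain w where w: "w \<in> A (Suc i)" using nonempty[OF i'] by blast
        then have "a < w" "w < z"
          using ordered[of i "Suc i"] right[OF i'] i' a rest by (auto simp: left_of_def)
        moreover have "w \<in> U" using w i' U_eq by blast
        ultimately show ?thesis using that[of w] letters[OF i' w] by (cases "odd i") auto
      qed
      then show ?thesis using conv[OF aR' z] clash by (meson less_imp_le)
    qed
  qed
  then show "R' = A i" using R' by blast
qed

lemma preceding_run:
  assumes "Suc i \<le> n"
  shows "preceding_run \<eta> U (A i) (A (Suc i))"
  unfolding preceding_run_def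
proof (intro conjI notI)
  show "is_run \<eta> U (A i)" "is_run \<eta> U (A (Suc i))" "left_of (A i) (A (Suc i))"
    using assms is_run ordered by auto
  assume "\<exists>c\<in>U. left_of (A i) {c} \<and> left_of {c} (A (Suc i))"
  then obtain c where c: "c \<in> U" "left_of (A i) {c}" "left_of {c} (A (Suc i))" by blast
  obtain a b where ab: "a \<in> A i" "b \<in> A (Suc i)" using nonempty[of i] nonempty[of "Suc i"] assms by auto
  have "i \<le> n" using assms by simp
  with c(1) show False
  proof (cases rule: U_cases)
    case (less j)
    then show False using ordered[of j i] c ab assms by (force simp: left_of_def)
  next
    case eq
    then show False using c by (auto simp: left_of_def)
  next
    case (greater j)
    then show False
      using ordered[of "Suc i" j] c ab by (cases "j = Suc i") (force simp: left_of_def)+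
  next
    case rest
    then show False using right[OF assms] c ab by (force simp: left_of_def)
  qed
qed

text \<open>No eligible run comes before \<open>A n\<close>: each of \<open>A 1\<close>, ...,
  \<open>A p\<close> is shorter than the block before it, no uncrossed site lies left of
  \<open>A 0\<close>, and every other run is contained in \<open>Z\<close>.\<close>

lemma selected:
  assumes n: "n = Suc p" and le: "ecard (A p) \<le> ecard (A n)"
    and decreasing: "\<And>i. i < p \<Longrightarrow> ecard (A (Suc i)) < ecard (A i)"
    and unbounded: "\<And>a. a \<in> A 0 \<Longrightarrow> \<exists>b\<in>A 0. b < a"
  shows "selected \<eta> U (A p) (A n)"
  unfolding selected_def
proof (intro conjI allI impI)
  show "eligible \<eta> U (A p) (A n)"
    using preceding_run[of p] n le by (simp add: eligible_def)
  fix P' R' assume el: "eligible \<eta> U P' R'"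
  then have pre: "preceding_run \<eta> U P' R'" and R': "is_run \<eta> U R'" and P': "P' \<noteq> {}"
    using is_run_nonempty by (auto simp: eligible_def preceding_run_def)
  show "R' = A n \<or> left_of (A n) R'"
  proof (cases "\<exists>i<n. R' \<inter> A i \<noteq> {}")
    case True
    then obtain i where i: "i < n" "R' = A i" using is_run_inter[OF R' is_run] by (meson disjoint_iff less_imp_le)
    show ?thesis
    proof (cases i)
      case 0
      obtain a where a: "a \<in> A 0" using nonempty by blast
      obtain q where q: "q \<in> P'" using P' by blast
      have q_less: "q < b" if "b \<in> A 0" for b
        using that q pre i 0 by (simp add: preceding_run_def left_of_def)
      have "q \<in> U" using q pre is_run_subset by (auto simp: preceding_run_def)
      then have "q \<in> A 0 \<or> a < q"
        using le0
      proof (cases rule: U_cases)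
        case (greater j)
        then show ?thesis using ordered[of 0 j] a by (simp add: left_of_def)
      next
        case rest
        then show ?thesis using right[of 0] a by (simp add: left_of_def)
      qed auto
      then show ?thesis using q_less[of q] q_less[OF a] by auto
    next
      case (Suc j)
      then have "P' = A j"
        using preceding_run_unique[OF pre] preceding_run[of j] i by auto
      then show ?thesis using decreasing[of j] el i Suc n by (auto simp: eligible_def)
    qed
  next
    case False
    show ?thesis
    proof (cases "R' \<inter> A n = {}")
      case True
      have "R' \<subseteq> U" using R' by (rule is_run_subset)
      have "z \<in> Z" if "z \<in> R'" for z
      proof -
        have "z \<in> U" using that \<open>R' \<subseteq> U\<close> by blast
        then consider j where "j \<le> n" "z \<in> A j" | "z \<in> Z" using U_eq by blast
        then show ?thesis
        proof cases
          case 1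
          then show ?thesis using that False True by (cases "j = n") (auto simp: disjoint_iff)
        qed
      qed
      then show ?thesis using right[of n] by (auto simp: left_of_def)
    next
      case False
      then show ?thesis using is_run_inter[OF R' is_run[of n]] by blast
    qed
  qed
qed

end

section \<open>Crossing out completed solitons\<close>

declare run_stack.simps(2) [simp del]

section \<open>Bookkeeping of crossed sites\<close>

definition crossed :: "(nat \<Rightarrow> int) \<Rightarrow> nat \<Rightarrow> nat set" where
  "crossed \<eta> x = \<Union>{\<gamma>. \<exists>k t. t \<le> x \<and> completed \<eta> k \<gamma> t}"

text \<open>The state of the algorithm after crossing exactly the solitons completed up to
  \<open>x\<close>; all unread and non-positive sites belong to it.\<close>

definition uncrossed :: "(nat \<Rightarrow> int) \<Rightarrow> nat \<Rightarrow> int set" where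
  "uncrossed \<eta> x = - int ` crossed \<eta> x"

definition sites :: "nat list list \<Rightarrow> nat set" where
  "sites S = \<Union>(set ` set S)"

lemma sites_simps [simp]: "sites [] = {}" "sites (R # S) = set R \<union> sites S"
  by (auto simp: sites_def)

lemma completed_unique:
  "completed \<eta> k \<gamma> x \<Longrightarrow> completed \<eta> k' \<gamma>' x \<Longrightarrow> k = k' \<and> \<gamma> = \<gamma>'"
  by (auto simp: completed_def)

lemma sites_grown:
  "sites (grown \<eta> (Suc x)) = sites (run_stack \<eta> x) \<union> (if level \<eta> (Suc x) = 0 then {} else {Suc x})"
  by (auto simp: grown_def grow_def level_def split: list.splits)

lemma crossed_0 [simp]: "crossed \<eta> 0 = {}"
  by (auto simp: crossed_def completed_def)

lemma crossed_Suc: "crossed \<eta> (Suc x) = crossed \<eta> x \<union> \<Union>{\<gamma>. \<exists>k. completed \<eta> k \<gamma> (Suc x)}"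
  by (auto simp: crossed_def le_Suc_eq)

lemma sites_cancel:
  assumes "x \<ge> 1"
  shows "sites (grown \<eta> x) = sites (cancel (grown \<eta> x)) \<union> \<Union>{\<gamma>. \<exists>k. completed \<eta> k \<gamma> x}"
  using assms by (cases "grown \<eta> x" rule: cancel.cases) (auto simp: completed_def)

context configuration
begin

lemma sites_cancel_disjoint:
  assumes "x \<ge> 1"
  shows "sites (cancel (grown \<eta> x)) \<inter> \<Union>{\<gamma>. \<exists>k. completed \<eta> k \<gamma> x} = {}"
  using grown_wf(1)[OF assms] assms
  by (cases "grown \<eta> x" rule: cancel.cases) (fastforce simp: completed_def wf_runs_Cons sites_def)+

text \<open>Sites are conserved: reading puts each non-record on the stack, and a cancellation moves
  two runs from the stack to the crossed sites.\<close>

lemma sites_crossed: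
  "sites (run_stack \<eta> x) \<union> crossed \<eta> x = {y \<in> {1..x}. level \<eta> y \<noteq> 0} \<and>
   sites (run_stack \<eta> x) \<inter> crossed \<eta> x = {}"
proof (induction x)
  case (Suc x)
  let ?N = "\<Union>{\<gamma>. \<exists>k. completed \<eta> k \<gamma> (Suc x)}"
  have G: "sites (grown \<eta> (Suc x)) = sites (run_stack \<eta> (Suc x)) \<union> ?N"
    using sites_cancel[of "Suc x"] by (simp add: run_stack_Suc)
  have disj: "sites (run_stack \<eta> (Suc x)) \<inter> ?N = {}"
    using sites_cancel_disjoint[of "Suc x"] by (simp add: run_stack_Suc)
  have "sites (run_stack \<eta> (Suc x)) \<union> crossed \<eta> (Suc x) = sites (grown \<eta> (Suc x)) \<union> crossed \<eta> x"
    by (auto simp: G crossed_Suc)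
  also have "\<dots> = {y \<in> {1..Suc x}. level \<eta> y \<noteq> 0}"
    using Suc by (auto simp: sites_grown le_Suc_eq)
  finally have "sites (run_stack \<eta> (Suc x)) \<union> crossed \<eta> (Suc x) = {y \<in> {1..Suc x}. level \<eta> y \<noteq> 0}" .
  moreover have "Suc x \<notin> crossed \<eta> x" using Suc by auto
  then have "sites (grown \<eta> (Suc x)) \<inter> crossed \<eta> x = {}"
    using Suc by (auto simp: sites_grown)
  then have "sites (run_stack \<eta> (Suc x)) \<inter> crossed \<eta> (Suc x) = {}"
    using disj by (auto simp: G crossed_Suc)
  ultimately show ?case by blast
qed simp

lemma level_0_iff: "level \<eta> (Suc x) = 0 \<longleftrightarrow> run_stack \<eta> x = [] \<and> \<eta> (Suc x) = 0"
  using binary[of "Suc x"] by (auto simp: level_Suc grow_def split: list.splits)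

text \<open>A record is read only on an empty stack, so everything stored now was read after
  it.\<close>

lemma record_less_sites:
  "y \<in> {1..x} \<Longrightarrow> level \<eta> y = 0 \<Longrightarrow> s \<in> sites (run_stack \<eta> x) \<Longrightarrow> y < s"
proof (induction x)
  case (Suc x)
  have s: "s \<in> sites (grown \<eta> (Suc x))"
    using Suc.prems sites_cancel[of "Suc x"] by (auto simp: run_stack_Suc)
  show ?case
  proof (cases "y = Suc x")
    case True
    then have "run_stack \<eta> x = []" "\<eta> (Suc x) = 0" using Suc.prems by (auto simp: level_0_iff)
    then have "grown \<eta> (Suc x) = []" by (simp add: grown_def grow_def)
    then show ?thesis using s by simp
  next
    case False
    then show ?thesis using Suc s by (auto simp: sites_grown split: if_splits)
  qed
qed simp

lemma hd_grown:
  assumes "level \<eta> (Suc x) \<noteq> 0"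
  shows "hd (hd (grown \<eta> (Suc x))) = Suc x \<and> grown \<eta> (Suc x) \<noteq> []"
  using assms by (auto simp: level_Suc grown_def grow_def split: list.splits if_splits)

section \<open>Completed solitons are steps of the algorithm\<close>

lemma uncrossed_cases:
  "z \<in> uncrossed \<eta> x \<longleftrightarrow> z \<le> 0 \<or> z > int x \<or>
     (\<exists>y\<in>{1..x}. z = int y \<and> (level \<eta> y = 0 \<or> y \<in> sites (run_stack \<eta> x)))"
proof (cases "1 \<le> z \<and> z \<le> int x")
  case True
  then obtain y where y: "z = int y" "y \<in> {1..x}" by (cases z) auto
  then show ?thesis using sites_crossed[of x] by (auto simp: uncrossed_def)
next
  case False
  have "nat z \<notin> crossed \<eta> x" "0 \<notin> crossed \<eta> x" using False sites_crossed[of x] by auto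
  then show ?thesis using False by (auto simp: uncrossed_def)
qed

text \<open>The uncrossed sites form a chain: the leading zeros, the runs of the grown stack, then
  the unread sites. The top two blocks are the selected pair, because the lower run and everything
  below it decrease strictly in length.\<close>

lemma completed_step:
  assumes comp: "completed \<eta> k \<gamma> (Suc x)"
  shows "ts_step \<eta> (uncrossed \<eta> x) k (int ` \<gamma>)"
proof -
  define G where "G = grown \<eta> (Suc x)"
  obtain R P S where RPS: "G = R # P # S" "length R = k" "length P = k" "\<gamma> = set R \<union> set P"
    using comp by (auto simp: completed_def G_def)
  have wf: "wf_runs \<eta> (Suc x) G" and weak: "weak_runs G"
    using grown_wf[of "Suc x"] by (auto simp: G_def)
  define n where "n = length G"
  have n: "n = Suc (Suc (length S))" by (simp add: n_def RPS)
  have level_pos: "level \<eta> (Suc x) \<noteq> 0"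
    using RPS wf by (auto simp: level_def G_def wf_runs_def)
  have last_R: "Suc x \<in> set R"
    using hd_grown[OF level_pos] wf RPS by (metis G_def hd_in_set list.sel(1) list.set_intros(1) wf_runs_nonempty)
  have sitesG: "sites G = sites (run_stack \<eta> x) \<union> {Suc x}"
    using sites_grown[of \<eta> x] level_pos by (simp add: G_def)
  \<comment> \<open>The unread letters that prolong the top run, whose letter is the parity of its
    height \<open>n\<close>; possibly none, possibly infinitely many.\<close>
  define tail where "tail = {z. z > int (Suc x) \<and> (\<forall>w. int (Suc x) < w \<and> w \<le> z \<longrightarrow> ext \<eta> w = of_bool (odd n))}"
  \<comment> \<open>The infinite leading run contains the records as well, all of which lie left of
    the stored sites.\<close>
  define base where "base = {z. z \<le> 0} \<union> int ` {y \<in> {1..x}. level \<eta> y = 0}"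
  \<comment> \<open>Stacks list the topmost run first, chains the leftmost one, and block 0 is not
    stored; hence the index \<open>n - i\<close>.\<close>
  define F where "F i = int ` set (G ! (n - i))" for i
  define A where "A i = (if i = 0 then base else if i = n then F i \<union> tail else F i)" for i
  define Z where "Z = {z. z > int (Suc x)} - tail"
  have Fn: "F n = int ` set R" and Fp: "F (n - 1) = int ` set P"
    by (auto simp: F_def RPS n)
  have F_set: "G ! (n - i) \<in> set G" if "1 \<le> i" "i \<le> n" for i
    using that n by (auto simp: n_def[symmetric] intro!: nth_mem)
  have F_sites: "(\<Union>i\<in>{1..n}. F i) = int ` sites G"
  proof -
    have "set ` set G = (\<lambda>i. set (G ! (n - i))) ` {1..n}"
    proof -
      have "\<exists>i\<in>{1..n}. Q = G ! (n - i)" if Q: "Q \<in> set G" for Q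
      proof -
        obtain j where "j < length G" "G ! j = Q" using Q by (auto simp: in_set_conv_nth)
        then have "n - j \<in> {1..n}" "Q = G ! (n - (n - j))" by (auto simp: n_def)
        then show ?thesis by blast
      qed
      moreover have "G ! (n - i) \<in> set G" if "i \<in> {1..n}" for i using F_set that by simp
      ultimately show ?thesis by blast
    qed
    then show ?thesis by (auto simp: sites_def F_def)
  qed
  have F_bounds: "1 \<le> z \<and> z \<le> int (Suc x)" if "1 \<le> i" "i \<le> n" "z \<in> F i" for i z
  proof -
    have "set (G ! (n - i)) \<subseteq> {1..Suc x}" using wf F_set that by (simp add: wf_runs_def)
    then show ?thesis using that by (force simp: F_def)
  qed
  have A_sub: "A i \<subseteq> base \<union> (\<Union>i\<in>{1..n}. F i) \<union> tail" if "i \<le> n" for i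
    using that by (auto simp: A_def)
  have A_Union: "(\<Union>i\<le>n. A i) = base \<union> (\<Union>i\<in>{1..n}. F i) \<union> tail"
  proof
    show "(\<Union>i\<le>n. A i) \<subseteq> base \<union> (\<Union>i\<in>{1..n}. F i) \<union> tail" using A_sub by blast
    have "A 0 = base" "A n = F n \<union> tail" "\<And>i. i \<in> {1..n} \<Longrightarrow> F i \<subseteq> A i"
      by (auto simp: A_def n)
    then show "base \<union> (\<Union>i\<in>{1..n}. F i) \<union> tail \<subseteq> (\<Union>i\<le>n. A i)" by fastforce
  qed
  have uncrossed_eq: "uncrossed \<eta> x = base \<union> int ` sites G \<union> {z. z > int (Suc x)}"
  proof -
    have sub: "sites (run_stack \<eta> x) \<subseteq> {1..x}" using sites_crossed[of x] by auto
    show ?thesis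
    proof (intro set_eqI)
      fix z
      show "z \<in> uncrossed \<eta> x \<longleftrightarrow> z \<in> base \<union> int ` sites G \<union> {z. z > int (Suc x)}"
        unfolding uncrossed_cases base_def sitesG using sub by (auto simp: image_iff)
    qed
  qed
  have tail_Z: "tail \<union> Z = {z. z > int (Suc x)}" by (auto simp: Z_def tail_def)
  have U: "uncrossed \<eta> x = (\<Union>i\<le>n. A i) \<union> Z"
    unfolding A_Union uncrossed_eq F_sites tail_Z[symmetric] by (simp only: Un_assoc)
  have record_less: "z < w" if "z \<in> base" "w \<in> int ` sites G" for z w
  proof -
    have "w \<in> (\<Union>i\<in>{1..n}. F i)" using that(2) F_sites by simp
    then obtain i where "i \<in> {1..n}" "w \<in> F i" by blast
    then have "w \<ge> 1" using F_bounds[of i w] by simp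
    then show ?thesis using that record_less_sites[of _ x] by (auto simp: base_def sitesG)
  qed
  have base_le: "z \<le> int x" if "z \<in> base" for z using that by (auto simp: base_def)
  \<comment> \<open>Index 0 is excluded because the top run ties with the second.\<close>
  have decr: "length (G ! i) < length (G ! j)" if "1 \<le> i" "i < j" "j < n" for i j
  proof -
    have "sorted_wrt (\<lambda>Q Q'. length Q < length Q') (P # S)"
      using weak by (simp add: RPS weak_runs_def strict_runs_def)
    then have "length ((P # S) ! (i - 1)) < length ((P # S) ! (j - 1))"
      by (rule sorted_wrt_nth_less) (use that n in auto)
    then show ?thesis using that by (simp add: RPS nth_Cons')
  qed
  have card_F: "card (F i) = length (G ! (n - i))" "finite (F i)" if "1 \<le> i" "i \<le> n" for i
  proof -
    have "sorted_wrt (>) (G ! (n - i))" using wf F_set that by (simp add: wf_runs_def)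
    then have "distinct (rev (G ! (n - i)))"
      using strict_sorted_iff[of "rev (G ! (n - i))"] by (simp add: sorted_wrt_rev)
    then have "distinct (G ! (n - i))" by simp
    then show "card (F i) = length (G ! (n - i))" "finite (F i)"
      by (simp_all add: F_def card_image distinct_card)
  qed
  interpret run_chain \<eta> "uncrossed \<eta> x" A n Z
  proof
    show "uncrossed \<eta> x = (\<Union>i\<le>n. A i) \<union> Z" by (fact U)
  next
    fix i assume i: "i \<le> n"
    have "G ! (n - i) \<noteq> []" if "i \<noteq> 0" using F_set[of i] wf_runs_nonempty[OF wf] i that by auto
    moreover have "0 \<in> base" by (simp add: base_def)
    ultimately show "A i \<noteq> {}" by (auto simp: A_def F_def)
  next
    fix i j assume ij: "i < j" "j \<le> n"
    have tail: "left_of (A i) tail"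
      using ij base_le F_bounds[of i] by (fastforce simp: left_of_def A_def tail_def)
    have "left_of (A i) (F j)"
    proof (cases "i = 0")
      case True
      have "F j \<subseteq> int ` sites G" using F_sites ij by auto
      then show ?thesis using record_less True by (auto simp: A_def left_of_def)
    next
      case False
      have "n - j < n - i" "n - i < length G" using ij False n_def by auto
      moreover have "sorted_wrt (\<lambda>Q Q'. \<forall>a\<in>set Q. \<forall>b\<in>set Q'. b < a) G"
        using wf by (simp add: wf_runs_def)
      ultimately have "\<forall>a\<in>set (G ! (n - j)). \<forall>b\<in>set (G ! (n - i)). b < a"
        using sorted_wrt_nth_less by fast
      then show ?thesis using ij False by (auto simp: A_def F_def left_of_def)
    qed
    then show "left_of (A i) (A j)" using tail ij by (auto simp: left_of_def A_def)
  next
    fix i assume i: "i \<le> n"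
    have tailZ: "t < z" if "t \<in> tail" "z \<in> Z" for t z
      using that by (force simp: tail_def Z_def)
    have "a \<le> int (Suc x) \<or> a \<in> tail" if "a \<in> A i" for a
      using that base_le[of a] F_bounds[of i a] i by (auto simp: A_def split: if_splits)
    then show "left_of (A i) Z" using tailZ by (force simp: left_of_def Z_def)
  next
    fix i z assume i: "i \<le> n" "z \<in> A i"
    consider "i = 0" "z \<in> base" | "1 \<le> i" "z \<in> F i" | "i = n" "z \<in> tail"
      using i by (auto simp: A_def split: if_splits)
    then show "ext \<eta> z = of_bool (odd i)"
    proof cases
      case 1
      have "\<eta> y = 0" if "y \<in> {1..x}" "level \<eta> y = 0" for y
        using that is_record_iff[of y] by (auto simp: is_record_def)
      then show ?thesis using 1 by (auto simp: ext_def base_def)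
    next
      case 2
      then obtain y where y: "y \<in> set (G ! (n - i))" "z = int y" by (auto simp: F_def)
      have "n - i < length G" using 2 i n n_def by auto
      then have "\<eta> y = of_bool (odd (n - (n - i)))" using wf y unfolding wf_runs_def n_def by blast
      moreover have "y \<ge> 1" using F_bounds[of i z] 2 i y by auto
      ultimately show ?thesis using y i by (simp add: ext_def)
    next
      case 3
      then show ?thesis by (auto simp: tail_def)
    qed
  next
    fix z assume z: "z \<in> Z"
    then obtain w where w: "int (Suc x) < w" "w \<le> z" "ext \<eta> w \<noteq> of_bool (odd n)"
      by (auto simp: Z_def tail_def)
    then have "w \<in> Z" by (auto simp: Z_def tail_def)
    then show "\<exists>w\<in>Z. w \<le> z \<and> ext \<eta> w \<noteq> of_bool (odd n)" using w by blast
  qed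
  define p where "p = Suc (length S)"
  have np: "n = Suc p" by (simp add: n p_def)
  have Ap: "A p = int ` set P" using Fp by (simp add: A_def np p_def)
  have An: "A n = int ` set R \<union> tail" using Fn by (simp add: A_def n)
  have cP: "card (int ` set P) = k" using card_F(1)[of p] Fp by (simp add: RPS n p_def)
  have cR: "card (int ` set R) = k" using card_F(1)[of n] Fn by (simp add: RPS n)
  have sel: "selected \<eta> (uncrossed \<eta> x) (A p) (A n)"
  proof (rule selected)
    show "n = Suc p" by (fact np)
    \<comment> \<open>If \<open>tail\<close> is infinite, the comparison in \<open>enat\<close> is
      trivial.\<close>
    have "card (int ` set R) \<le> card (A n)" if "finite (A n)" using that An card_mono by blast
    then show "ecard (A p) \<le> ecard (A n)" using cP cR by (auto simp: ecard_def Ap)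
  next
    fix i assume i: "i < p"
    have A1: "A (Suc i) = F (Suc i)" using i np by (simp add: A_def)
    show "ecard (A (Suc i)) < ecard (A i)"
    proof (cases "i = 0")
      case True
      have "infinite {z::int. z \<le> 0}" using infinite_Iic by (simp add: atMost_def)
      then have "infinite (A i)" using True by (simp add: A_def base_def)
      then show ?thesis using card_F(2)[of "Suc i"] i np by (simp add: A1 ecard_def)
    next
      case False
      then have "A i = F i" using i np by (simp add: A_def)
      moreover have "length (G ! (n - Suc i)) < length (G ! (n - i))"
        using False i np by (intro decr) auto
      ultimately show ?thesis
        using card_F[of "Suc i"] card_F[of i] i False np by (simp add: A1 ecard_def)
    qed
  next
    fix a assume a: "a \<in> A 0"
    show "\<exists>b\<in>A 0. b < a"
      by (rule bexI[of _ "- \<bar>a\<bar> - 1"]) (auto simp: A_def base_def)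
  qed
  have last: "last_letters k (A p) = int ` set P"
  proof -
    have "ecard {q \<in> int ` set P. p < q} < enat k" if "p \<in> int ` set P" for p
    proof -
      have "card {q \<in> int ` set P. p < q} < card (int ` set P)"
        by (rule psubset_card_mono) (use that in auto)
      then show ?thesis using cP by (simp add: ecard_def)
    qed
    then show ?thesis by (auto simp: last_letters_def Ap)
  qed
  have Rtail: "r < t" if "r \<in> int ` set R" "t \<in> tail" for r t
    using that F_bounds[of n r] Fn n by (auto simp: tail_def)
  have first: "first_letters k (A n) = int ` set R"
  proof -
    have "ecard {s \<in> A n. s < r} < enat k" if r: "r \<in> int ` set R" for r
    proof -
      have "{s \<in> A n. s < r} = {s \<in> int ` set R. s < r}" using Rtail r by (force simp: An)
      moreover have "card {s \<in> int ` set R. s < r} < card (int ` set R)"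
        by (rule psubset_card_mono) (use r in auto)
      ultimately show ?thesis using cR by (simp add: ecard_def)
    qed
    \<comment> \<open>All \<open>k\<close> sites of \<open>R\<close> precede every unread letter, so
      \<open>tail\<close> contributes none of the first \<open>k\<close>.\<close>
    moreover have "\<not> ecard {s \<in> A n. s < r} < enat k" if r: "r \<in> tail" for r
    proof -
      have "int ` set R \<subseteq> {s \<in> A n. s < r}" using Rtail r by (auto simp: An)
      then have "finite {s \<in> A n. s < r} \<Longrightarrow> k \<le> card {s \<in> A n. s < r}"
        using cR card_mono by blast
      then show ?thesis by (auto simp: ecard_def)
    qed
    ultimately show ?thesis unfolding first_letters_def An by blast
  qed
  have "\<exists>z\<in>uncrossed \<eta> x. ext \<eta> z = 1"
  proof -
    \<comment> \<open>One of the top two blocks has odd index and hence consists of ones.\<close>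
    define i where "i = (if odd n then n else p)"
    have i: "i \<le> n" "odd i" using np by (auto simp: i_def)
    obtain z where "z \<in> A i" using nonempty[OF i(1)] by blast
    then show ?thesis using letters[OF i(1)] i U by (intro bexI[of _ z]) auto
  qed
  moreover have "ecard (A p) = enat k" using cP by (simp add: Ap ecard_def)
  moreover have "int ` \<gamma> = first_letters k (A n) \<union> last_letters k (A p)"
    by (simp only: first last RPS image_Un)
  ultimately show ?thesis unfolding ts_step_def using sel by blast
qed

end

section \<open>Slots and the two decompositions\<close>

text \<open>Ones minus zeros in the stack: every further zero lowers it by 1, so the stack gets empty.\<close>

primrec imbalance :: "nat list list \<Rightarrow> int" where
  "imbalance [] = 0"
| "imbalance (R # S) = (if even (length S) then int (length R) else - int (length R)) + imbalance S"

lemma imbalance_cancel: "imbalance (cancel S) = imbalance S"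
  by (cases S rule: cancel.cases) auto

lemma imbalance_grow:
  assumes "\<eta> x = 0" "S \<noteq> []"
  shows "imbalance (grow \<eta> x S) = imbalance S - 1"
  using assms by (cases S) (auto simp: grow_def)

text \<open>The bottom stored run consists of ones, and every run of zeros is outweighed by the
  longer run of ones below it. The second conjunct strengthens the induction: with ones on top, a
  shorter run of zeros cannot bring the imbalance down to 0.\<close>

lemma imbalance_pos:
  assumes "strict_runs S" "\<forall>Q\<in>set S. Q \<noteq> []" "S \<noteq> []"
  shows "imbalance S > 0 \<and> (odd (length S) \<longrightarrow> imbalance S \<ge> int (length (hd S)))"
  using assms
proof (induction S)
  case (Cons R S)
  show ?case
  proof (cases S)
    case Nil
    then show ?thesis using Cons.prems by simp
  next
    case (Cons P S')
    then have "imbalance S > 0 \<and> (odd (length S) \<longrightarrow> imbalance S \<ge> int (length P))"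
      using Cons.IH Cons.prems by simp
    moreover have "length R < length P" using Cons Cons.prems by simp
    ultimately show ?thesis by auto
  qed
qed simp

section \<open>Counting completed solitons\<close>

definition completions :: "(nat \<Rightarrow> int) \<Rightarrow> nat \<Rightarrow> nat set" where
  "completions \<eta> k = {t. \<exists>\<gamma>. completed \<eta> k \<gamma> t}"

definition letter :: "arrow \<Rightarrow> int" where
  "letter \<sigma> = (case \<sigma> of Up \<Rightarrow> 1 | Down \<Rightarrow> 0)"

text \<open>The excess of \<open>m\<close> over the number of completed \<open>k\<close>-solitons,
  as \<open>m_eq\<close> shows. Runs are constant, so the head gives the letter.\<close>

definition run_count :: "(nat \<Rightarrow> int) \<Rightarrow> arrow \<Rightarrow> nat \<Rightarrow> nat list list \<Rightarrow> nat" where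
  "run_count \<eta> \<sigma> k S = length (filter (\<lambda>R. length R = k \<and> \<eta> (hd R) = letter \<sigma>) S)"

lemma strict_runs_same_length:
  "strict_runs S \<Longrightarrow> R \<in> set S \<Longrightarrow> R' \<in> set S \<Longrightarrow> length R = length R' \<Longrightarrow> R = R'"
  by (induction S) auto

text \<open>At most one run has length \<open>k\<close>, and it carries only one of the two
  letters.\<close>

lemma run_count_0:
  assumes "strict_runs S"
  shows "\<exists>\<sigma>. run_count \<eta> \<sigma> k S = 0"
proof (rule ccontr)
  assume "\<nexists>\<sigma>. run_count \<eta> \<sigma> k S = 0"
  then have "\<exists>R\<in>set S. length R = k \<and> \<eta> (hd R) = letter \<sigma>" for \<sigma>
    by (auto simp: run_count_def filter_empty_conv)
  from this[of Up] this[of Down] obtain R R' where "R \<in> set S" "R' \<in> set S" "length R = k" "length R' = k"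
    "\<eta> (hd R) = 1" "\<eta> (hd R') = 0" by (auto simp: letter_def)
  moreover from this have "R = R'" using strict_runs_same_length[OF assms] by blast
  ultimately show False by simp
qed

lemma card_count_Suc:
  "card (T \<inter> {1..Suc x}) = card (T \<inter> {1..x}) + of_bool (Suc x \<in> T)"
proof -
  have "T \<inter> {1..Suc x} = (if Suc x \<in> T then insert (Suc x) (T \<inter> {1..x}) else T \<inter> {1..x})"
    by (auto simp: le_Suc_eq)
  then show ?thesis by simp
qed

text \<open>\<open>\<tau>\<close> is the generalised inverse of the counting function
  \<open>D\<close>. As \<open>D\<close> jumps by one exactly on \<open>T\<close>, each
  \<open>t\<close> in \<open>T\<close> is recovered from \<open>D t\<close>, and a finite value of
  \<open>\<tau>\<close> at a positive argument lies in \<open>T\<close>.\<close>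

lemma counting_inverse:
  fixes T X :: "nat set"
  assumes T: "0 \<notin> T" and D: "\<And>x. D x = card (T \<inter> {1..x})"
    and \<tau>: "\<And>j. \<tau> j = Inf (enat ` {x. j \<le> D x})"
  shows "bij_betw D (T \<inter> X) {j. j \<ge> 1 \<and> \<tau> j \<in> enat ` X}"
proof -
  have mono: "D x \<le> D y" if "x \<le> y" for x y
    unfolding D using that by (intro card_mono) auto
  have D_0: "D 0 = 0" by (simp add: D)
  have step: "D (Suc x) = D x + of_bool (Suc x \<in> T)" for x
    unfolding D by (rule card_count_Suc)
  have inv: "\<tau> (D t) = enat t \<and> D t \<ge> 1" if t: "t \<in> T" for t
  proof -
    obtain u where u: "t = Suc u" using t T by (cases t) auto
    have "t \<le> x" if "D t \<le> D x" for x
      using that mono[of x u] step[of u] t u by (cases "x \<le> u") auto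
    then have "enat t \<le> \<tau> (D t)" unfolding \<tau> by (auto intro!: Inf_greatest)
    moreover have "\<tau> (D t) \<le> enat t" unfolding \<tau> by (auto intro!: Inf_lower)
    ultimately show ?thesis using step[of u] t u by simp
  qed
  show ?thesis
  proof (rule bij_betwI')
    fix s t assume "s \<in> T \<inter> X" "t \<in> T \<inter> X"
    then show "D s = D t \<longleftrightarrow> s = t" using inv by (metis IntD1 enat.inject)
  next
    fix t assume "t \<in> T \<inter> X"
    then show "D t \<in> {j. j \<ge> 1 \<and> \<tau> j \<in> enat ` X}" using inv by auto
  next
    fix j assume "j \<in> {j. j \<ge> 1 \<and> \<tau> j \<in> enat ` X}"
    then obtain x where j: "j \<ge> 1" and x: "\<tau> j = enat x" "x \<in> X" by auto
    have "{x. j \<le> D x} \<noteq> {}"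
    proof
      assume "{x. j \<le> D x} = {}"
      then have "\<tau> j = \<infinity>" by (simp add: \<tau> top_enat_def)
      then show False using x by simp
    qed
    then obtain y where "enat y \<in> enat ` {x. j \<le> D x}" by auto
    from wellorder_InfI[OF this] have "\<tau> j \<in> enat ` {x. j \<le> D x}" unfolding \<tau> .
    then have le: "j \<le> D x" using x by auto
    then obtain u where u: "x = Suc u" using j D_0 by (cases x) auto
    \<comment> \<open>By minimality of \<open>x\<close>, \<open>D\<close> is below \<open>j\<close>
      one site earlier, so it jumps at \<open>x\<close> to exactly \<open>j\<close>.\<close>
    have "\<not> j \<le> D u"
    proof
      assume "j \<le> D u"
      then have "\<tau> j \<le> enat u" unfolding \<tau> by (auto intro!: Inf_lower)
      then show False using x u by simp
    qed
    then show "\<exists>t\<in>T \<inter> X. j = D t"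
      using le step[of u] x u by (intro bexI[of _ x]) (cases "Suc u \<in> T"; auto)+
  qed
qed

text \<open>With steps 0 or 1 no value is skipped, so \<open>s i\<close> is also the first site with
  value at least \<open>i\<close>; by monotonicity the level set ends just before
  \<open>s (i + 1)\<close>.\<close>

lemma level_set_interval:
  fixes f :: "nat \<Rightarrow> int"
  assumes f0: "f 0 = 0" and step: "\<And>x. f (Suc x) = f x \<or> f (Suc x) = f x + 1"
    and unbounded: "\<And>i. \<exists>x. int i \<le> f x" and s: "\<And>i. s i = (LEAST x. f x = int i)"
  shows "{s i .. s (i + 1) - 1} = {x. f x = int i}"
proof -
  have mono: "f x \<le> f y" if "x \<le> y" for x y
    using lift_Suc_mono_le[of f x y] step that by (metis add_increasing2 order_refl zero_le_one)
  have hit: "\<exists>y\<le>x. f y = int i" if "int i \<le> f x" for i x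
  proof -
    have "\<bar>f (j + 1) - f j\<bar> \<le> 1" for j using step[of j] by auto
    then show ?thesis using nat0_intermed_int_val[of x f "int i"] f0 that by auto
  qed
  have f_s: "f (s i) = int i" for i
    unfolding s using unbounded[of i] hit by (metis (mono_tags, lifting) LeastI)
  have ge: "s i \<le> x \<longleftrightarrow> int i \<le> f x" for i x
  proof
    assume "s i \<le> x"
    then show "int i \<le> f x" using mono[of "s i" x] f_s by simp
  next
    assume "int i \<le> f x"
    then obtain y where "y \<le> x" "f y = int i" using hit by blast
    then show "s i \<le> x" unfolding s by (meson Least_le le_trans)
  qed
  \<comment> \<open>Subtraction is truncated, so positivity is what makes
    \<open>s (i + 1) - 1\<close> the true predecessor.\<close>
  have "s (i + 1) \<noteq> 0" using f_s[of "i + 1"] f0 by (metis of_nat_eq_0_iff add_is_0 one_neq_zero)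
  then have "x \<le> s (i + 1) - 1 \<longleftrightarrow> \<not> s (i + 1) \<le> x" for x by auto
  then show ?thesis unfolding atLeastAtMost_def using ge by auto
qed

lemma ecard_bij_betw: "bij_betw f A B \<Longrightarrow> ecard A = ecard B"
  by (simp add: ecard_def bij_betw_finite bij_betw_same_card)

context configuration
begin

text \<open>A letter of level \<open>k\<close> produces a run of length \<open>k\<close>, one of
  level \<open>k + 1\<close> uses one up: the same increments as in \<open>m\<close>.\<close>

lemma run_count_grow:
  assumes "k \<ge> 1"
  shows "int (run_count \<eta> \<sigma> k (grown \<eta> (Suc x))) = int (run_count \<eta> \<sigma> k (run_stack \<eta> x))
    + of_bool (level \<eta> (Suc x) = k \<and> \<eta> (Suc x) = letter \<sigma>)
    - of_bool (level \<eta> (Suc x) = k + 1 \<and> \<eta> (Suc x) = letter \<sigma>)"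
proof (cases "odd (length (run_stack \<eta> x)) \<longleftrightarrow> \<eta> (Suc x) = 1")
  case True
  show ?thesis
  proof (cases "run_stack \<eta> x")
    case Nil
    then show ?thesis using True assms by (simp add: grown_def grow_def level_Suc)
  next
    case (Cons R S)
    have "\<eta> (hd R) = of_bool (even (length S))"
      using run_stack_wf[of x] by (auto simp: Cons wf_runs_Cons)
    also have "\<dots> = \<eta> (Suc x)" using True Cons binary[of "Suc x"] by auto
    finally show ?thesis
      using True assms Cons by (auto simp: grown_def grow_def level_Suc run_count_def)
  qed
next
  case False
  then show ?thesis using assms by (auto simp: grown_def grow_def level_Suc run_count_def)
qed

text \<open>The cancelled runs are adjacent and have opposite letters, so a completion lowers the
  count by one for either arrow.\<close>

lemma run_count_cancel:
  "run_count \<eta> \<sigma> k (grown \<eta> (Suc x)) =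
     run_count \<eta> \<sigma> k (run_stack \<eta> (Suc x)) + of_bool (Suc x \<in> completions \<eta> k)"
proof (cases "grown \<eta> (Suc x)" rule: cancel.cases)
  case (1 R P S)
  have "wf_runs \<eta> (Suc x) (R # P # S)" using grown_wf[of "Suc x"] 1 by simp
  then have "\<eta> (hd R) = of_bool (odd (length S))" "\<eta> (hd P) = of_bool (even (length S))"
    by (auto simp: wf_runs_Cons)
  then show ?thesis
    using 1 by (cases \<sigma>) (auto simp: run_stack_Suc completions_def completed_def run_count_def letter_def)
qed (auto simp: run_stack_Suc completions_def completed_def)

lemma m_eq:
  assumes "k \<ge> 1"
  shows "m \<eta> \<sigma> k x = int (card (completions \<eta> k \<inter> {1..x})) + int (run_count \<eta> \<sigma> k (run_stack \<eta> x))"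
proof (induction x)
  case 0
  show ?case by (simp add: m_def run_count_def)
next
  case (Suc x)
  have change: "seat_change \<eta> \<sigma> l (Suc x) = of_bool (level \<eta> (Suc x) = l \<and> \<eta> (Suc x) = letter \<sigma>)"
    if "l \<ge> 1" for l
    using seat_change_eq[OF that, of "Suc x"] by (cases \<sigma>) (auto simp: letter_def)
  have "m \<eta> \<sigma> k (Suc x) = m \<eta> \<sigma> k x + seat_change \<eta> \<sigma> k (Suc x) - seat_change \<eta> \<sigma> (k + 1) (Suc x)"
    by (simp add: m_def)
  also have "\<dots> = int (card (completions \<eta> k \<inter> {1..x})) + int (run_count \<eta> \<sigma> k (grown \<eta> (Suc x)))"
    using Suc change[of k] change[of "k + 1"] run_count_grow[OF assms, of \<sigma> x] assms by linarith
  finally show ?case unfolding run_count_cancel card_count_Suc by simp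
qed

lemma m_ge_iff:
  assumes "k \<ge> 1"
  shows "(\<forall>\<sigma>. int j \<le> m \<eta> \<sigma> k x) \<longleftrightarrow> j \<le> card (completions \<eta> k \<inter> {1..x})"
proof -
  obtain \<sigma> where "run_count \<eta> \<sigma> k (run_stack \<eta> x) = 0"
    using run_count_0 run_stack_wf by blast
  then have "m \<eta> \<sigma> k x = int (card (completions \<eta> k \<inter> {1..x}))" by (simp add: m_eq[OF assms])
  moreover have "int (card (completions \<eta> k \<inter> {1..x})) \<le> m \<eta> \<sigma> k x" for \<sigma>
    by (simp add: m_eq[OF assms])
  ultimately show ?thesis by (metis of_nat_le_iff order_trans)
qed

lemma zeta_eq:
  assumes "k \<ge> 1"
  shows "zeta \<eta> k i = ecard (completions \<eta> k \<inter> {x. xi \<eta> k x = int i})"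
proof -
  have "0 \<notin> completions \<eta> k" by (simp add: completions_def completed_def)
  moreover have "tau \<eta> k j = Inf (enat ` {x. j \<le> card (completions \<eta> k \<inter> {1..x})})" for j
    by (simp add: tau_def m_ge_iff[OF assms])
  ultimately show ?thesis
    unfolding zeta_def by (intro ecard_bij_betw[symmetric] counting_inverse) auto
qed

text \<open>A site changes only the seat given by its level, so the double sum counts the sites of
  level between 1 and \<open>k\<close>.\<close>

lemma xi_eq: "xi \<eta> k x = (\<Sum>y = 1..x. of_bool (level \<eta> y = 0 \<or> level \<eta> y > k))"
proof -
  have "(\<Sum>l = 1..k. seat_change \<eta> Up l y + seat_change \<eta> Down l y)
      = of_bool (1 \<le> level \<eta> y \<and> level \<eta> y \<le> k)" if "y \<in> {1..x}" for y
  proof -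
    have "(\<Sum>l = 1..k. seat_change \<eta> Up l y + seat_change \<eta> Down l y)
        = (\<Sum>l = 1..k. of_bool (level \<eta> y = l))"
      using seat_change_eq binary[of y] that by (intro sum.cong) auto
    also have "\<dots> = of_bool (1 \<le> level \<eta> y \<and> level \<eta> y \<le> k)" by (simp add: of_bool_def)
    finally show ?thesis .
  qed
  then have "(\<Sum>l = 1..k. \<Sum>y = 1..x. seat_change \<eta> Up l y + seat_change \<eta> Down l y)
      = (\<Sum>y = 1..x. of_bool (1 \<le> level \<eta> y \<and> level \<eta> y \<le> k))"
    by (subst sum.swap) (intro sum.cong refl)
  then have "xi \<eta> k x = (\<Sum>y = 1..x. 1 - of_bool (1 \<le> level \<eta> y \<and> level \<eta> y \<le> k))"
    by (simp add: xi_def sum_subtractf)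
  also have "\<dots> = (\<Sum>y = 1..x. of_bool (level \<eta> y = 0 \<or> level \<eta> y > k))"
    by (intro sum.cong) auto
  finally show ?thesis .
qed

lemma xi_Suc: "xi \<eta> k (Suc x) = xi \<eta> k x + of_bool (level \<eta> (Suc x) = 0 \<or> level \<eta> (Suc x) > k)"
  by (simp add: xi_eq)

section \<open>Sites of a completed soliton\<close>

text \<open>The soliton is determined by its last site, which \<open>Max\<close> recovers.
  \<open>xi \<eta> k\<close> stays constant along it: the level bound of the lower run excludes
  levels above \<open>k\<close>, and the first site, still on the stack, excludes records.\<close>

lemma completed_bounds:
  assumes "completed \<eta> k \<gamma> t"
  shows "finite \<gamma>" "Max \<gamma> = t" "t \<in> \<gamma>"
    and "y \<in> \<gamma> \<Longrightarrow> xi \<eta> k y = xi \<eta> k t"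
proof -
  obtain R P S where G: "grown \<eta> t = R # P # S" "length R = k" "length P = k" "\<gamma> = set R \<union> set P"
    and t: "t \<ge> 1" using assms by (auto simp: completed_def)
  obtain u where u: "t = Suc u" using t by (cases t) auto
  have wf: "wf_runs \<eta> t (R # P # S)" using grown_wf[OF t] G by simp
  have lev: "level \<eta> t \<noteq> 0" using G wf by (auto simp: level_def wf_runs_def)
  have tR: "t \<in> set R"
    using hd_grown[of u] lev wf_runs_nonempty[OF wf] G by (metis u hd_in_set list.sel(1) list.set_intros(1))
  show fin: "finite \<gamma>" "t \<in> \<gamma>" using G tR by auto
  have bound: "\<gamma> \<subseteq> {1..t}" using wf G by (auto simp: wf_runs_Cons)
  then show "Max \<gamma> = t" using fin by (intro Max_eqI) auto
  have PR: "a < b" if "a \<in> set P" "b \<in> set R" for a b using wf that by (auto simp: wf_runs_Cons)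
  \<comment> \<open>Runs list later sites first, so \<open>last P\<close> is the first site of the
    soliton.\<close>
  have last_P: "last P \<in> set P" using wf by (simp add: wf_runs_Cons)
  have last_le: "last P \<le> y" if "y \<in> \<gamma>" for y
  proof (cases "y \<in> set P")
    case True
    have "sorted_wrt (>) P" using wf by (simp add: wf_runs_Cons)
    moreover have "P = butlast P @ [last P]" using wf by (simp add: wf_runs_Cons)
    ultimately have "sorted_wrt (>) (butlast P @ [last P])" "y \<in> set (butlast P @ [last P])"
      using True by simp_all
    then show ?thesis unfolding sorted_wrt_append by (auto simp del: append_butlast_last_id)
  next
    case False
    then show ?thesis using that PR[OF last_P] G by force
  qed
  have "last P < t" using PR[OF last_P tR] .
  moreover have "last P \<in> sites (grown \<eta> t)" using last_P G by auto
  ultimately have last_site: "last P \<in> sites (run_stack \<eta> u)"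
    by (auto simp: u sites_grown split: if_splits)
  have inner: "1 \<le> level \<eta> y \<and> level \<eta> y \<le> k" if y: "last P \<le> y" "y \<le> t" for y
  proof -
    have "level \<eta> y \<noteq> 0"
    proof (cases "y = t")
      case False
      have "last P \<ge> 1" using bound last_P G by auto
      then show ?thesis
        using record_less_sites[OF _ _ last_site, of y] y False by (fastforce simp: u)
    qed (use lev in simp)
    moreover have "level \<eta> y \<le> k" using wf y G by (simp add: wf_runs_Cons)
    ultimately show ?thesis by simp
  qed
  have const: "xi \<eta> k (last P + n) = xi \<eta> k (last P)" if "last P + n \<le> t" for n
    using that
  proof (induction n)
    case (Suc n)
    then show ?case using inner[of "last P + Suc n"] by (auto simp: xi_Suc)
  qed simp
  show "xi \<eta> k y = xi \<eta> k t" if "y \<in> \<gamma>"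
    using const[of "y - last P"] const[of "t - last P"] last_le[OF that] last_le[OF fin(2)] bound that
    by auto
qed

lemma completed_component:
  assumes "completed \<eta> k \<gamma> t"
  shows "1 \<le> l \<Longrightarrow> l \<le> k \<Longrightarrow> level \<eta> (component \<gamma> l) = l \<and> level \<eta> (component \<gamma> (l + k)) = l"
    and "x \<in> \<gamma> \<Longrightarrow> \<exists>l. 1 \<le> l \<and> l \<le> k \<and> (x = component \<gamma> l \<or> x = component \<gamma> (l + k))"
proof -
  obtain R P S where G: "grown \<eta> t = R # P # S" "length R = k" "length P = k" "\<gamma> = set R \<union> set P"
    and t: "t \<ge> 1" using assms by (auto simp: completed_def)
  have wf: "wf_runs \<eta> t (R # P # S)" using grown_wf[OF t] G by simp
  \<comment> \<open>The increasing list of the sites of the soliton: its first \<open>k\<close>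
    entries are the lower run, so entry \<open>l + k\<close> is the \<open>l\<close>-th letter of
    the upper run.\<close>
  define L where "L = rev P @ rev R"
  have "sorted_wrt (<) L"
    using wf by (auto simp: L_def wf_runs_Cons sorted_wrt_append sorted_wrt_rev)
  then have "sorted L" "distinct L" by (simp_all add: strict_sorted_iff)
  then have "sorted_list_of_set (set L) = L" by (rule sorted_list_of_set.idem_if_sorted_distinct)
  moreover have "set L = \<gamma>" by (auto simp: L_def G)
  ultimately have comp: "component \<gamma> l = L ! (l - 1)" for l by (simp add: component_def)
  have L: "L ! (l - 1) = rev P ! (l - 1)" "L ! (l + k - 1) = rev R ! (l - 1)" if "1 \<le> l" "l \<le> k" for l
    using that G by (auto simp: L_def nth_append)
  show "level \<eta> (component \<gamma> l) = l \<and> level \<eta> (component \<gamma> (l + k)) = l" if l: "1 \<le> l" "l \<le> k"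
  proof -
    have lev: "level \<eta> (rev Q ! (l - 1)) = l" if "Q \<in> {P, R}" for Q
    proof -
      have "length Q = k" and "map (level \<eta>) (rev Q) = [1..<Suc (length Q)]"
        using that wf G by (auto simp: wf_runs_Cons simp del: upt_Suc)
      then have "map (level \<eta>) (rev Q) ! (l - 1) = [1..<Suc k] ! (l - 1)" by simp
      then show ?thesis using l \<open>length Q = k\<close> by (simp del: upt_Suc)
    qed
    then show ?thesis using L[OF l] by (simp add: comp)
  qed
  show "\<exists>l. 1 \<le> l \<and> l \<le> k \<and> (x = component \<gamma> l \<or> x = component \<gamma> (l + k))" if "x \<in> \<gamma>"
  proof -
    have "x \<in> set (rev P) \<or> x \<in> set (rev R)" using that G by auto
    then obtain i where i: "i < k" "x = rev P ! i \<or> x = rev R ! i"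
      unfolding in_set_conv_nth using G by auto
    then show ?thesis using L[of "Suc i"] by (intro exI[of _ "Suc i"]) (auto simp: comp)
  qed
qed

section \<open>Agreement of the reading with the algorithm\<close>

lemma uncrossed_Suc:
  "completed \<eta> k \<gamma> (Suc x) \<Longrightarrow> uncrossed \<eta> (Suc x) = uncrossed \<eta> x - int ` \<gamma>"
  "\<not> (\<exists>k \<gamma>. completed \<eta> k \<gamma> (Suc x)) \<Longrightarrow> uncrossed \<eta> (Suc x) = uncrossed \<eta> x"
proof -
  assume c: "completed \<eta> k \<gamma> (Suc x)"
  then have "{\<gamma>. \<exists>k. completed \<eta> k \<gamma> (Suc x)} = {\<gamma>}" using completed_unique by blast
  then show "uncrossed \<eta> (Suc x) = uncrossed \<eta> x - int ` \<gamma>"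
    by (auto simp: uncrossed_def crossed_Suc)
next
  assume "\<not> (\<exists>k \<gamma>. completed \<eta> k \<gamma> (Suc x))"
  then show "uncrossed \<eta> (Suc x) = uncrossed \<eta> x" by (simp add: uncrossed_def crossed_Suc)
qed

lemma ts_state_uncrossed: "ts_state \<eta> (uncrossed \<eta> x)"
proof (induction x)
  case 0
  show ?case using ts_state.start by (simp add: uncrossed_def)
next
  case (Suc x)
  then show ?case using uncrossed_Suc completed_step ts_state.cross by metis
qed

end

section \<open>Finite configurations\<close>

locale finite_configuration = configuration +
  assumes finitely_many: "\<exists>N. \<forall>x>N. \<eta> x = 0"
begin

text \<open>From some site on only zeros are read. Each lowers the imbalance by one while the stack
  is nonempty, yet a nonempty stack has positive imbalance; and an empty stack stays empty under
  zeros.\<close>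

lemma eventually_empty: "\<exists>N. \<forall>x\<ge>N. run_stack \<eta> x = [] \<and> level \<eta> (Suc x) = 0"
proof -
  obtain N where N: "\<And>x. x > N \<Longrightarrow> \<eta> x = 0" using finitely_many by blast
  have empty: "run_stack \<eta> (Suc x) = []" if "run_stack \<eta> x = []" "x \<ge> N" for x
    using that N[of "Suc x"] by (simp add: run_stack_Suc grown_def grow_def)
  have "run_stack \<eta> (N + n) = [] \<or> imbalance (run_stack \<eta> (N + n)) = imbalance (run_stack \<eta> N) - int n"
    for n
  proof (induction n)
    case (Suc n)
    show ?case
    proof (cases "run_stack \<eta> (N + n) = []")
      case True
      then show ?thesis using empty[of "N + n"] by simp
    next
      case False
      then show ?thesis
        using Suc imbalance_grow[of \<eta> "Suc (N + n)" "run_stack \<eta> (N + n)"] N[of "Suc (N + n)"]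
        by (simp add: run_stack_Suc grown_def imbalance_cancel)
    qed
  qed simp
  \<comment> \<open>As many zeros as the imbalance at \<open>N\<close> bring it down to at most
    0.\<close>
  from this[of "nat (imbalance (run_stack \<eta> N))"]
  obtain M where M: "M \<ge> N" "run_stack \<eta> M = [] \<or> imbalance (run_stack \<eta> M) \<le> 0"
    by (metis diff_le_0_iff_le le_add1 int_nat_eq nat_le_eq_zle order_refl linorder_le_cases nat_0_le)
  then have M_empty: "run_stack \<eta> M = []"
    using imbalance_pos run_stack_wf wf_runs_nonempty by (meson linorder_not_le)
  have "run_stack \<eta> x = []" if "x \<ge> M" for x
    using that
  proof (induction rule: dec_induct)
    case (step n)
    then show ?case using empty[of n] M by simp
  qed (fact M_empty)
  then show ?thesis using M N by (intro exI[of _ M]) (auto simp: level_0_iff)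
qed

text \<open>At a later moment with empty stack, every non-record read so far has been
  crossed.\<close>

lemma level_pos_completed:
  assumes "x \<ge> 1" "level \<eta> x \<noteq> 0"
  shows "\<exists>k \<gamma> t. completed \<eta> k \<gamma> t \<and> x \<in> \<gamma>"
proof -
  obtain N where "run_stack \<eta> (max N x) = []" using eventually_empty by (metis max.cobounded1)
  then have "x \<in> crossed \<eta> (max N x)" using sites_crossed[of "max N x"] assms by auto
  then show ?thesis by (auto simp: crossed_def)
qed

text \<open>A step requires an uncrossed 1, which is not a record and so belongs to a soliton
  completed after \<open>x\<close>. The first completion after \<open>x\<close> starts from the same
  uncrossed set, and determinism identifies the two crossings.\<close>

lemma next_completion:
  assumes step: "ts_step \<eta> (uncrossed \<eta> x) k C"
  shows "\<exists>\<gamma> t. completed \<eta> k \<gamma> t \<and> C = int ` \<gamma> \<and> uncrossed \<eta> x - C = uncrossed \<eta> t"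
proof -
  have "\<exists>t>x. \<exists>k \<gamma>. completed \<eta> k \<gamma> t"
  proof (rule ccontr)
    assume none: "\<not> ?thesis"
    obtain z where z: "z \<in> uncrossed \<eta> x" "ext \<eta> z = 1" using step by (auto simp: ts_step_def)
    then obtain y where y: "z = int y" "y \<ge> 1" "\<eta> y = 1"
      by (cases z) (auto simp: ext_def split: if_splits)
    have "level \<eta> y \<noteq> 0" using y is_record_iff[of y] by (auto simp: is_record_def)
    then obtain k \<gamma> t where "completed \<eta> k \<gamma> t" "y \<in> \<gamma>" using level_pos_completed y by blast
    moreover from this none have "t \<le> x" by (meson linorder_not_le)
    ultimately have "y \<in> crossed \<eta> x" by (auto simp: crossed_def)
    then show False using z y by (simp add: uncrossed_def)
  qed
  then obtain t where t: "x < t" "\<exists>k \<gamma>. completed \<eta> k \<gamma> t"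
    "\<And>s. x < s \<Longrightarrow> s < t \<Longrightarrow> \<not> (\<exists>k \<gamma>. completed \<eta> k \<gamma> s)"
    using exists_least_iff[of "\<lambda>t. x < t \<and> (\<exists>k \<gamma>. completed \<eta> k \<gamma> t)"] by blast
  obtain u where u: "t = Suc u" using t(1) by (cases t) auto
  have "x \<le> u" using t u by simp
  then have "uncrossed \<eta> u = uncrossed \<eta> x"
  proof (induction rule: inc_induct)
    case (step n)
    then show ?case using uncrossed_Suc(2)[of n] t(3)[of "Suc n"] u by simp
  qed simp
  moreover obtain k' \<gamma> where c: "completed \<eta> k' \<gamma> (Suc u)" using t u by blast
  ultimately have "k = k' \<and> C = int ` \<gamma>" "uncrossed \<eta> (Suc u) = uncrossed \<eta> x - int ` \<gamma>"
    using completed_step[OF c] ts_step_unique[OF step] uncrossed_Suc(1)[OF c] by simp_all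
  then show ?thesis using c by blast
qed

lemma ts_state_imp_uncrossed: "ts_state \<eta> U \<Longrightarrow> \<exists>x. U = uncrossed \<eta> x"
proof (induction rule: ts_state.induct)
  case start
  show ?case by (intro exI[of _ 0]) (simp add: uncrossed_def)
next
  case (cross U k C)
  then obtain x where x: "U = uncrossed \<eta> x" by blast
  then show ?case using cross next_completion by metis
qed

lemma soliton_iff: "soliton \<eta> k \<gamma> \<longleftrightarrow> (\<exists>t. completed \<eta> k \<gamma> t)"
proof
  assume "soliton \<eta> k \<gamma>"
  then obtain x where "ts_step \<eta> (uncrossed \<eta> x) k (int ` \<gamma>)"
    using ts_state_imp_uncrossed by (auto simp: soliton_def)
  then obtain \<gamma>' t where "completed \<eta> k \<gamma>' t" "int ` \<gamma> = int ` \<gamma>'" using next_completion by blast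
  then show "\<exists>t. completed \<eta> k \<gamma> t" by (metis inj_image_eq_iff inj_of_nat)
next
  assume "\<exists>t. completed \<eta> k \<gamma> t"
  then obtain t where t: "completed \<eta> k \<gamma> t" by blast
  then obtain u where "t = Suc u" by (cases t) (auto simp: completed_def)
  then show "soliton \<eta> k \<gamma>"
    using completed_step t ts_state_uncrossed unfolding soliton_def by blast
qed

text \<open>Any soliton having \<open>x\<close> as component \<open>l\<close> or
  \<open>l + k\<close> forces level \<open>l\<close>, and a record forces level 0. The description
  is therefore unique without comparing different solitons.\<close>

lemma slot_eq:
  assumes "x \<ge> 1"
  shows "slot \<eta> x = (if level \<eta> x = 0 then \<infinity> else enat (level \<eta> x - 1))"
  unfolding slot_def
proof (rule the_equality)
  show "(\<exists>k \<gamma> l. soliton \<eta> k \<gamma> \<and> 1 \<le> l \<and> l \<le> k \<and> (x = component \<gamma> l \<or> x = component \<gamma> (l + k)) \<and>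
      (if level \<eta> x = 0 then \<infinity> else enat (level \<eta> x - 1)) = enat (l - 1)) \<or>
    is_record \<eta> x \<and> (if level \<eta> x = 0 then \<infinity> else enat (level \<eta> x - 1)) = \<infinity>"
  proof (cases "level \<eta> x = 0")
    case True
    then show ?thesis using assms by (simp add: is_record_iff)
  next
    case False
    then obtain k \<gamma> t where c: "completed \<eta> k \<gamma> t" "x \<in> \<gamma>" using level_pos_completed assms by blast
    then obtain l where l: "1 \<le> l" "l \<le> k" "x = component \<gamma> l \<or> x = component \<gamma> (l + k)"
      using completed_component(2) by blast
    then have "level \<eta> x = l" using completed_component(1)[OF c(1)] by blast
    then show ?thesis using c l soliton_iff by (intro disjI1) auto
  qed
next
  fix v
  assume "(\<exists>k \<gamma> l. soliton \<eta> k \<gamma> \<and> 1 \<le> l \<and> l \<le> k \<and> (x = component \<gamma> l \<or> x = component \<gamma> (l + k)) \<and>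
      v = enat (l - 1)) \<or> is_record \<eta> x \<and> v = \<infinity>"
  then show "v = (if level \<eta> x = 0 then \<infinity> else enat (level \<eta> x - 1))"
  proof (elim disjE exE conjE)
    fix k \<gamma> l
    assume "soliton \<eta> k \<gamma>" and l: "1 \<le> l" "l \<le> k" and v: "v = enat (l - 1)"
    then obtain t where c: "completed \<eta> k \<gamma> t" by (auto simp: soliton_iff)
    note lev = completed_component(1)[OF c l]
    show ?thesis if "x = component \<gamma> l" using lev that v l by auto
    show ?thesis if "x = component \<gamma> (l + k)" using lev that v l by auto
  qed (use assms is_record_iff in auto)
qed

lemma seat_change_iff_slot:
  assumes "k \<ge> 1" "x \<ge> 1"
  shows "seat_change \<eta> Up k x + seat_change \<eta> Down k x = 1 \<longleftrightarrow> slot \<eta> x = enat (k - 1)"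
  using assms binary[of x] by (auto simp: seat_change_eq slot_eq simp del: seat_change.simps)

lemma xi_slot_eq: "xi_slot \<eta> k x = xi \<eta> k x"
  unfolding xi_slot_def xi_eq by (intro sum.cong refl) (auto simp: slot_eq)

lemma xi_unbounded: "\<exists>x. int i \<le> xi \<eta> k x"
proof -
  obtain N where N: "\<And>x. x \<ge> N \<Longrightarrow> level \<eta> (Suc x) = 0" using eventually_empty by blast
  have "xi \<eta> k N \<ge> 0" unfolding xi_eq by (intro sum_nonneg) auto
  then have "int n \<le> xi \<eta> k (N + n)" for n
  proof (induction n)
    case (Suc n)
    then show ?case using N[of "N + n"] by (simp add: xi_Suc)
  qed simp
  then show ?thesis by blast
qed

text \<open>As \<open>xi \<eta> k\<close> is constant on a soliton, the soliton lies in the interval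
  as soon as its last site does. Sending solitons to their last sites is thus a bijection onto the
  set counted in \<open>zeta_eq\<close>.\<close>

lemma zeta_slot_eq:
  assumes "k \<ge> 1"
  shows "zeta_slot \<eta> k i = zeta \<eta> k i"
proof -
  have interval: "{s_slot \<eta> k i .. s_slot \<eta> k (i + 1) - 1} = {x. xi \<eta> k x = int i}"
  proof (rule level_set_interval)
    show "xi \<eta> k 0 = 0" by (simp add: xi_eq)
    show "xi \<eta> k (Suc x) = xi \<eta> k x \<or> xi \<eta> k (Suc x) = xi \<eta> k x + 1" for x by (auto simp: xi_Suc)
    show "\<exists>x. int i \<le> xi \<eta> k x" for i by (rule xi_unbounded)
    show "s_slot \<eta> k i = (LEAST x. xi \<eta> k x = int i)" for i by (simp add: s_slot_def xi_slot_eq)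
  qed
  let ?A = "{\<gamma>. soliton \<eta> k \<gamma> \<and> \<gamma> \<subseteq> {s_slot \<eta> k i .. s_slot \<eta> k (i + 1) - 1}}"
  have "bij_betw Max ?A (completions \<eta> k \<inter> {x. xi \<eta> k x = int i})"
  proof (rule bij_betwI')
    fix \<gamma> \<gamma>' assume "\<gamma> \<in> ?A" "\<gamma>' \<in> ?A"
    then obtain t t' where "completed \<eta> k \<gamma> t" "completed \<eta> k \<gamma>' t'" by (auto simp: soliton_iff)
    then show "Max \<gamma> = Max \<gamma>' \<longleftrightarrow> \<gamma> = \<gamma>'" using completed_bounds(2) completed_unique by metis
  next
    fix \<gamma> assume "\<gamma> \<in> ?A"
    then have "soliton \<eta> k \<gamma>" "\<gamma> \<subseteq> {x. xi \<eta> k x = int i}" unfolding interval by blast+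
    then obtain t where c: "completed \<eta> k \<gamma> t" and sub: "\<gamma> \<subseteq> {x. xi \<eta> k x = int i}"
      by (auto simp: soliton_iff)
    then show "Max \<gamma> \<in> completions \<eta> k \<inter> {x. xi \<eta> k x = int i}"
      using completed_bounds(2,3)[OF c] c by (auto simp: completions_def)
  next
    fix t assume "t \<in> completions \<eta> k \<inter> {x. xi \<eta> k x = int i}"
    then obtain \<gamma> where c: "completed \<eta> k \<gamma> t" and "xi \<eta> k t = int i" by (auto simp: completions_def)
    then have "\<gamma> \<in> ?A" using completed_bounds(4)[OF c] unfolding interval by (auto simp: soliton_iff)
    then show "\<exists>\<gamma>\<in>?A. t = Max \<gamma>" using completed_bounds(2)[OF c] by blast
  qed
  then show ?thesis unfolding zeta_slot_def zeta_eq[OF assms] by (rule ecard_bij_betw)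
qed

end

lemma finite_configuration_Omega_fin:
  assumes "\<eta> \<in> Omega_fin"
  shows "finite_configuration \<eta>"
proof
  show binary: "\<eta> x = 0 \<or> \<eta> x = 1" if "x \<ge> 1" for x
    using assms that by (auto simp: Omega_fin_def Omega_def)
  \<comment> \<open>The terms of a convergent series tend to 0, and a letter of absolute value below
    1 is 0.\<close>
  have "(\<lambda>n. real_of_int (\<eta> (Suc n))) \<longlonglongrightarrow> 0"
    using assms by (auto simp: Omega_fin_def intro: summable_LIMSEQ_zero)
  then have "\<forall>\<^sub>F n in sequentially. norm (real_of_int (\<eta> (Suc n))) < 1"
    by (metis tendsto_norm_zero order_tendstoD(2) zero_less_one)
  then obtain N where N: "\<And>n. n \<ge> N \<Longrightarrow> norm (real_of_int (\<eta> (Suc n))) < 1"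
    by (auto simp: eventually_sequentially)
  have "\<eta> x = 0" if x: "x > N" for x
  proof -
    obtain n where "x = Suc n" "n \<ge> N" using x by (cases x) auto
    then show ?thesis using N[of n] binary[of x] by auto
  qed
  then show "\<exists>N. \<forall>x>N. \<eta> x = 0" by blast
qed

theorem proposition2p3:
  fixes \<eta> :: "nat \<Rightarrow> int"
  assumes "\<eta> \<in> Omega_fin"
  shows "(\<forall>k\<ge>1. \<forall>x\<ge>1.
            seat_change \<eta> Up k x + seat_change \<eta> Down k x = 1 \<longleftrightarrow> slot \<eta> x = enat (k - 1)) \<and>
         (\<forall>k\<ge>1. \<forall>x. xi_slot \<eta> k x = xi \<eta> k x) \<and>
         (\<forall>k\<ge>1. \<forall>i. zeta_slot \<eta> k i = zeta \<eta> k i)"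
proof -
  interpret finite_configuration \<eta> using assms by (rule finite_configuration_Omega_fin)
  show ?thesis using seat_change_iff_slot xi_slot_eq zeta_slot_eq by blast
qed

end
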